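(* Let $n$ be a positive integer, let $d$ be an integer with $0\le d \le n-1$, and let $m$ be an integer with $0\le m\le\binom{n+1}{2}$ and \[ m \ge dn-\binom{d}{2} -n + d + 1. \] Let $E \subseteq \mathrm{Gr}(m,\mathcal{S}^n)$ be the set of linear spaces that contain a positive definite matrix but do not contain a PSD matrix of rank $n-d$. Then $E$ lies inside a Zariski-closed proper subset of $\mathrm{Gr}(m,\mathcal{S}^n)$.
   Context: $\mathcal{S}^n$ is the vector space of real symmetric $n\times n$ matrices; PSD means positive semidefinite. $\mathrm{Gr}(m,\mathcal{S}^n)$ is the Grassmannian of $m$-dimensional linear subspaces of $\mathcal{S}^n$, viewed as a real projective variety via Plücker coordinates. *)

theory Defs
  imports
    "Jordan_Normal_Form.Determinant"
    "HOL-Library.Poly_Mapping"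
    "HOL-Analysis.Analysis"
begin

no_notation Matrix.vec_index (infixl \<open>$\<close> 100)
no_notation Matrix.scalar_prod (infix \<open>\<bullet>\<close> 70)

section \<open>Symmetric matrices\<close>

definition sym_mats :: "(real ^ 'n ^ 'n) set" where
  "sym_mats = {A. Finite_Cartesian_Product.transpose A = A}"

definition positive_definite :: "real ^ 'n ^ 'n \<Rightarrow> bool" where
  "positive_definite A \<longleftrightarrow> A \<in> sym_mats \<and> (\<forall>x. x \<noteq> 0 \<longrightarrow> x \<bullet> (A *v x) > 0)"

definition positive_semidefinite :: "real ^ 'n ^ 'n \<Rightarrow> bool" where
  "positive_semidefinite A \<longleftrightarrow> A \<in> sym_mats \<and> (\<forall>x. x \<bullet> (A *v x) \<ge> 0)"

section \<open>The Grassmannian of subspaces of the symmetric matrices\<close>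

definition Gr_sym :: "nat \<Rightarrow> (real ^ 'n ^ 'n) set set" where
  "Gr_sym m = {L. subspace L \<and> L \<subseteq> sym_mats \<and> dim L = m}"

definition ordered_basis :: "(real ^ 'n ^ 'n) list \<Rightarrow> (real ^ 'n ^ 'n) set \<Rightarrow> bool" where
  "ordered_basis bs L \<longleftrightarrow> distinct bs \<and> independent (set bs) \<and> span (set bs) = L"

text \<open>
  Pluecker coordinates are taken in skew-symmetric form: there is one coordinate for every
  sequence of \<open>m\<close> matrix positions, whether or not it is increasing.  This needs no order on
  the index type, and the coordinates not belonging to increasing sequences of positions
  \<open>(i, j)\<close> with \<open>i \<le> j\<close> are \<open>0\<close> or, up to sign, repeat those that do.
\<close>

definition plucker_indices :: "nat \<Rightarrow> ('n \<times> 'n) list set" where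
  "plucker_indices m = {I. length I = m}"

definition plucker :: "(real ^ 'n ^ 'n) list \<Rightarrow> ('n \<times> 'n) list \<Rightarrow> real" where
  "plucker bs I = Determinant.det
     (Matrix.mat (length bs) (length bs) (\<lambda>(k, l). bs ! k $ fst (I ! l) $ snd (I ! l)))"

section \<open>Zariski-closed subsets\<close>

text \<open>
  A polynomial with variables indexed by \<open>'v\<close> maps exponent vectors to coefficients.
\<close>

type_synonym 'v real_mpoly = "('v \<Rightarrow>\<^sub>0 nat) \<Rightarrow>\<^sub>0 real"

definition mpoly_vars :: "'v real_mpoly \<Rightarrow> 'v set" where
  "mpoly_vars f = (\<Union>e\<in>Poly_Mapping.keys f. Poly_Mapping.keys e)"

definition mpoly_eval :: "('v \<Rightarrow> real) \<Rightarrow> 'v real_mpoly \<Rightarrow> real" where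
  "mpoly_eval p f =
     (\<Sum>e\<in>Poly_Mapping.keys f.
        Poly_Mapping.lookup f e * (\<Prod>v\<in>Poly_Mapping.keys e. p v ^ Poly_Mapping.lookup e v))"

definition mpoly_homogeneous :: "'v real_mpoly \<Rightarrow> bool" where
  "mpoly_homogeneous f \<longleftrightarrow>
     (\<exists>k. \<forall>e\<in>Poly_Mapping.keys f. (\<Sum>v\<in>Poly_Mapping.keys e. Poly_Mapping.lookup e v) = k)"

text \<open>
  Changing the basis of \<open>L\<close> multiplies all its Pluecker coordinates by one nonzero scalar, so
  for homogeneous \<open>f\<close> the vanishing condition does not depend on the basis.
\<close>

definition zariski_closed_Gr :: "nat \<Rightarrow> (real ^ 'n ^ 'n) set set \<Rightarrow> bool" where
  "zariski_closed_Gr m Z \<longleftrightarrow>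
     (\<exists>F. (\<forall>f\<in>F. mpoly_homogeneous f \<and> mpoly_vars f \<subseteq> plucker_indices m) \<and>
          Z = {L \<in> Gr_sym m. \<forall>f\<in>F. \<forall>bs. ordered_basis bs L \<longrightarrow> mpoly_eval (plucker bs) f = 0})"

end

theory Submission
  imports Defs
begin

text \<open>
  Call a space \<open>L\<close> of symmetric matrices \<^emph>\<open>rank-degenerate\<close> if it contains some \<open>A \<noteq> 0\<close> for which
  some symmetric \<open>C \<noteq> 0\<close> orthogonal to \<open>L\<close> satisfies \<open>A C = 0\<close>. The symmetric \<open>C\<close> with \<open>A C = 0\<close>
  are the normal directions at \<open>A\<close> of the manifold of symmetric matrices of rank \<open>rank A\<close>, so \<open>L\<close>
  is nondegenerate exactly when it is transverse to all rank strata away from the origin. The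
  theorem follows from two facts.

  A nondegenerate \<open>m\<close>-dimensional \<open>L\<close> that contains a positive definite matrix contains a PSD
  matrix of rank \<open>n - d\<close> (\<open>nondegenerate_contains_psd_of_rank\<close>). Let \<open>A\<close> be a nonzero PSD matrix
  in \<open>L\<close> whose kernel has dimension \<open>e < d\<close>. The lower bound on \<open>m\<close> implies that the matrices in
  \<open>L\<close> that vanish on the kernel of \<open>A\<close> form a space of dimension at least two
  (\<open>linear_conditions_on_kernel\<close>), and a line in this space that is parallel to \<open>A\<close> but misses the
  origin meets the boundary of its PSD cone in a nonzero PSD matrix of smaller rank
  (\<open>psd_boundary_in_pencil\<close>). So the rank can be pushed down to at most \<open>n - d\<close>. This may
  overshoot, but transversality repairs it: near a nonzero PSD matrix of rank \<open>r < n\<close> in a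
  nondegenerate \<open>L\<close> there is one of rank \<open>r + 1\<close> (\<open>nondegenerate_rank_increase\<close>, an application of
  the open mapping theorem of Sussmann).

  The degenerate spaces lie in a hypersurface of the Grassmannian (\<open>degenerate_in_hypersurface\<close>).
  Let \<open>N\<close> be the dimension of the space of symmetric matrices. The pairs \<open>(A, C)\<close> of nonzero
  matrices with \<open>A C = 0\<close>, up to scaling \<open>A\<close> and \<open>C\<close>, form a family with \<open>N - 2\<close> parameters,
  whatever the rank of \<open>A\<close>: if the columns with index in \<open>W\<close> are a basis of the column space of
  \<open>A\<close>, then \<open>A\<close>, \<open>C\<close> are determined by the block of \<open>A\<close> on \<open>W\<close>, the block of \<open>C\<close> on the complement
  of \<open>W\<close>, and the coefficients expressing the other columns, which together have the shape of one
  symmetric matrix (\<open>annihilating_pair_parametrized\<close>). The spaces between the line of \<open>A\<close> and the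
  hyperplane orthogonal to \<open>C\<close> need \<open>(m - 1) (N - m - 1)\<close> further parameters. The total is \<open>m (N -
  m) - 1\<close>, one less than the dimension of the Grassmannian. By a count of coefficients, finitely
  many families with that few parameters satisfy a common nontrivial homogeneous equation
  (\<open>low_dimensional_image_in_hypersurface\<close>), which is then read as an equation in the Pluecker
  coordinates.
\<close>

section \<open>Homogeneous linear systems and separately polynomial functions\<close>

lemma homogeneous_system_nontrivial_solution:
  fixes h :: "'e \<Rightarrow> 'g \<Rightarrow> real"
  assumes "finite G" "finite E" "card G < card E"
  shows "\<exists>c. (\<exists>e\<in>E. c e \<noteq> 0) \<and> (\<forall>g\<in>G. (\<Sum>e\<in>E. c e * h e g) = 0)"
  using assms
proof (induction G arbitrary: E h rule: finite_induct)
  case empty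
  then have "E \<noteq> {}" by auto
  then show ?case by (intro exI[of _ "\<lambda>_. 1"]) auto
next
  case (insert g G)
  show ?case
  proof (cases "\<forall>e\<in>E. h e g = 0")
    case True
    have "card G < card E" using insert by simp
    from insert.IH[OF insert.prems(1) this, of h] obtain c where
      "\<exists>e\<in>E. c e \<noteq> 0" "\<forall>g\<in>G. (\<Sum>e\<in>E. c e * h e g) = 0" by blast
    with True show ?thesis by (intro exI[of _ c]) (auto intro: sum.neutral)
  next
    case False
    then obtain e0 where e0: "e0 \<in> E" "h e0 g \<noteq> 0" by blast
    define E' where "E' = E - {e0}"
    have E': "finite E'" "card G < card E'" "e0 \<notin> E'" "E = insert e0 E'"
      using insert e0 by (auto simp: E'_def)
    define h' where "h' = (\<lambda>e g'. h e g' - h e g / h e0 g * h e0 g')"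
    from insert.IH[OF E'(1,2), of h'] obtain c where
      c: "\<exists>e\<in>E'. c e \<noteq> 0" "\<forall>g'\<in>G. (\<Sum>e\<in>E'. c e * h' e g') = 0" by blast
    \<comment> \<open>the value at the pivot is forced by the new equation\<close>
    define c0 where "c0 = - (\<Sum>e\<in>E'. c e * h e g) / h e0 g"
    have expand: "(\<Sum>e\<in>E. (c(e0 := c0)) e * h e g') = c0 * h e0 g' + (\<Sum>e\<in>E'. c e * h e g')" for g'
    proof -
      have "(\<Sum>e\<in>E'. (c(e0 := c0)) e * h e g') = (\<Sum>e\<in>E'. c e * h e g')"
        using E'(3) by (intro sum.cong) auto
      then show ?thesis unfolding E'(4) using E'(1,3) by simp
    qed
    have "(\<Sum>e\<in>E. (c(e0 := c0)) e * h e g') = 0" if "g' \<in> insert g G" for g'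
    proof (cases "g' = g")
      case True
      then show ?thesis using e0 expand[of g] by (simp add: c0_def)
    next
      case False
      then have "0 = (\<Sum>e\<in>E'. c e * h' e g')" using c(2) that by auto
      also have "\<dots> = (\<Sum>e\<in>E'. c e * h e g' - c e * h e g * (h e0 g' / h e0 g))"
        by (intro sum.cong) (auto simp: h'_def algebra_simps)
      also have "\<dots> = (\<Sum>e\<in>E'. c e * h e g') - (\<Sum>e\<in>E'. c e * h e g) * (h e0 g' / h e0 g)"
        by (simp only: sum_subtractf sum_distrib_right)
      finally show ?thesis using expand[of g'] e0 by (simp add: c0_def)
    qed
    moreover have "\<exists>e\<in>E. (c(e0 := c0)) e \<noteq> 0" using c(1) E' by auto
    ultimately show ?thesis by blast
  qed
qed

text \<open>
  Polynomiality in each variable of \<open>K\<close> separately, with a common degree bound, is stable under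
  sums and products for trivial reasons, and it suffices for the only property of polynomials in
  several variables that the dimension count needs: they vanish as soon as they vanish on a large
  grid.
\<close>

definition sep_poly :: "'k set \<Rightarrow> nat \<Rightarrow> (('k \<Rightarrow> real) \<Rightarrow> real) \<Rightarrow> bool" where
  "sep_poly K D f \<longleftrightarrow> (\<forall>v\<in>K. \<forall>x. \<exists>p. degree p \<le> D \<and> (\<forall>t. f (x(v := t)) = poly p t))"

lemma sep_poly_const: "sep_poly K D (\<lambda>x. c)"
  unfolding sep_poly_def by (intro ballI allI exI[of _ "[:c:]"]) auto

lemma sep_poly_var: "D \<ge> 1 \<Longrightarrow> sep_poly K D (\<lambda>x :: 'k \<Rightarrow> real. x k)"
  unfolding sep_poly_def
proof (intro ballI allI)
  fix v :: 'k and x :: "'k \<Rightarrow> real" assume "D \<ge> 1" "v \<in> K"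
  then show "\<exists>p. degree p \<le> D \<and> (\<forall>t. (x(v := t)) k = poly p t)"
    by (intro exI[of _ "if v = k then [:0,1:] else [:x k:]"]) auto
qed

lemma sep_poly_mono: "sep_poly K D f \<Longrightarrow> D \<le> D' \<Longrightarrow> sep_poly K D' f"
  unfolding sep_poly_def by (meson order_trans)

lemma sep_poly_add: "sep_poly K D f \<Longrightarrow> sep_poly K D g \<Longrightarrow> sep_poly K D (\<lambda>x. f x + g x)"
  unfolding sep_poly_def by (metis degree_add_le poly_add)

lemma sep_poly_uminus: "sep_poly K D f \<Longrightarrow> sep_poly K D (\<lambda>x. - f x)"
  unfolding sep_poly_def by (metis degree_minus poly_minus)

lemma sep_poly_diff: "sep_poly K D f \<Longrightarrow> sep_poly K D g \<Longrightarrow> sep_poly K D (\<lambda>x. f x - g x)"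
  unfolding sep_poly_def by (metis degree_diff_le poly_diff)

lemma sep_poly_mult:
  "sep_poly K D f \<Longrightarrow> sep_poly K D' g \<Longrightarrow> sep_poly K (D + D') (\<lambda>x. f x * g x)"
  unfolding sep_poly_def by (metis add_mono degree_mult_le order_trans poly_mult)

lemma sep_poly_sum:
  assumes "\<And>i. i \<in> I \<Longrightarrow> sep_poly K D (f i)"
  shows "sep_poly K D (\<lambda>x. \<Sum>i\<in>I. f i x)"
  using assms
  by (induction I rule: infinite_finite_induct) (auto intro: sep_poly_const sep_poly_add)

lemma sep_poly_prod:
  assumes "\<And>i. i \<in> I \<Longrightarrow> sep_poly K D (f i)"
  shows "sep_poly K (card I * D) (\<lambda>x. \<Prod>i\<in>I. f i x)"
  using assms
  by (induction I rule: infinite_finite_induct)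
     (auto intro: sep_poly_const sep_poly_mult simp del: add_mult_distrib)

text \<open>
  Variables are released from the grid one at a time: with the other variables fixed, a polynomial
  of degree at most \<open>D\<close> in one variable has the \<open>D + 1\<close> roots \<open>0, \<dots>, D\<close>.
\<close>

lemma sep_poly_zero_on_grid:
  assumes "finite K" "sep_poly K D f"
    and "\<And>y. (\<forall>v\<in>K. \<exists>i\<le>D. y v = real i) \<Longrightarrow> (\<forall>v. v \<notin> K \<longrightarrow> y v = x v) \<Longrightarrow> f y = 0"
  shows "f x = 0"
  using assms
proof (induction K arbitrary: x rule: finite_induct)
  case empty
  then show ?case by auto
next
  case (insert v K)
  from insert.prems(1) have spK: "sep_poly K D f" by (auto simp: sep_poly_def)
  obtain p where p: "degree p \<le> D" "\<And>t. f (x(v := t)) = poly p t"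
    using insert.prems(1) by (auto simp: sep_poly_def) blast
  have root: "poly p (real i) = 0" if "i \<le> D" for i
  proof -
    have "f (x(v := real i)) = 0"
    proof (rule insert.IH[OF spK])
      fix y assume y: "\<forall>v\<in>K. \<exists>i\<le>D. y v = real i" "\<forall>w. w \<notin> K \<longrightarrow> y w = (x(v := real i)) w"
      have "y v = real i" using y(2) insert.hyps by auto
      then show "f y = 0" using y that insert.prems(2)[of y] by auto
    qed
    then show ?thesis by (simp add: p)
  qed
  have "p = 0"
  proof (rule ccontr)
    assume "p \<noteq> 0"
    have "real ` {..D} \<subseteq> {t. poly p t = 0}" using root by auto
    then have "card (real ` {..D}) \<le> card {t. poly p t = 0}"
      by (intro card_mono poly_roots_finite \<open>p \<noteq> 0\<close>)
    also have "\<dots> \<le> D" using card_poly_roots_bound[OF \<open>p \<noteq> 0\<close>] p(1) by simp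
    finally show False by (simp add: card_image inj_on_def)
  qed
  then have "f (x(v := x v)) = 0" by (simp only: p poly_0)
  then show ?case by simp
qed

text \<open>
  For \<open>q = 1\<close> these are the polynomials in the variables \<open>V\<close> of degree below \<open>D\<close> in each of them,
  written in the unnormalized Lagrange basis of the grid \<open>{0, \<dots>, D - 1}\<close> to the power \<open>V\<close>; the
  variable \<open>q\<close> homogenizes them. In this basis it is visible that a nonzero coefficient gives a
  nonzero function, and that the form is a combination of products of linear forms.
\<close>

definition lagrange_form :: "'v set \<Rightarrow> nat \<Rightarrow> (('v \<Rightarrow> nat) \<Rightarrow> real) \<Rightarrow> ('v \<Rightarrow> real) \<Rightarrow> real \<Rightarrow> real"
  where "lagrange_form V D c T q =
    (\<Sum>w \<in> V \<rightarrow>\<^sub>E {..<D}. c w * (\<Prod>v\<in>V. \<Prod>j\<in>{..<D} - {w v}. T v - real j * q))"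

lemma lagrange_form_scale:
  assumes "lagrange_form V D c T q = 0"
  shows "lagrange_form V D c (\<lambda>v. a * T v) (a * q) = 0"
proof -
  have "lagrange_form V D c (\<lambda>v. a * T v) (a * q) = a ^ (card V * (D - 1)) * lagrange_form V D c T q"
    unfolding lagrange_form_def sum_distrib_left
  proof (intro sum.cong refl)
    fix w assume w: "w \<in> V \<rightarrow>\<^sub>E {..<D}"
    have "(\<Prod>v\<in>V. \<Prod>j\<in>{..<D} - {w v}. a * T v - real j * (a * q))
        = (\<Prod>v\<in>V. a ^ (D - 1) * (\<Prod>j\<in>{..<D} - {w v}. T v - real j * q))"
    proof (intro prod.cong refl)
      fix v assume "v \<in> V"
      then have "card ({..<D} - {w v}) = D - 1" using w by (auto simp: card_Diff_singleton PiE_def Pi_def)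
      moreover have "(\<Prod>j\<in>{..<D} - {w v}. a * T v - real j * (a * q))
          = (\<Prod>j\<in>{..<D} - {w v}. a * (T v - real j * q))"
        by (intro prod.cong) (auto simp: algebra_simps)
      ultimately show "(\<Prod>j\<in>{..<D} - {w v}. a * T v - real j * (a * q))
          = a ^ (D - 1) * (\<Prod>j\<in>{..<D} - {w v}. T v - real j * q)"
        by (simp add: prod.distrib)
    qed
    also have "\<dots> = a ^ (card V * (D - 1)) * (\<Prod>v\<in>V. \<Prod>j\<in>{..<D} - {w v}. T v - real j * q)"
      by (simp add: prod.distrib power_mult[symmetric] mult.commute)
    finally show "c w * (\<Prod>v\<in>V. \<Prod>j\<in>{..<D} - {w v}. a * T v - real j * (a * q))
       = a ^ (card V * (D - 1)) * (c w * (\<Prod>v\<in>V. \<Prod>j\<in>{..<D} - {w v}. T v - real j * q))"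
      by simp
  qed
  with assms show ?thesis by simp
qed

lemma lagrange_form_at_node:
  assumes "finite V" "w0 \<in> V \<rightarrow>\<^sub>E {..<D}" "c w0 \<noteq> 0"
  shows "lagrange_form V D c (\<lambda>v. real (w0 v)) 1 \<noteq> 0"
proof -
  let ?P = "\<lambda>w. \<Prod>v\<in>V. \<Prod>j\<in>{..<D} - {w v}. real (w0 v) - real j * 1"
  have "?P w = 0" if w: "w \<in> V \<rightarrow>\<^sub>E {..<D}" "w \<noteq> w0" for w
  proof -
    obtain v where v: "v \<in> V" "w v \<noteq> w0 v" using w assms(2) by (metis PiE_ext)
    then have "w0 v \<in> {..<D} - {w v}" using assms(2) by auto
    then have "(\<Prod>j\<in>{..<D} - {w v}. real (w0 v) - real j * 1) = 0" by (intro prod_zero) auto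
    then show ?thesis using v(1) assms(1) by (intro prod_zero) auto
  qed
  then have "lagrange_form V D c (\<lambda>v. real (w0 v)) 1 = (\<Sum>w \<in> {w0}. c w * ?P w)"
    unfolding lagrange_form_def using assms
    by (intro sum.mono_neutral_right) (auto intro!: finite_PiE)
  also have "\<dots> = c w0 * ?P w0" by simp
  also have "\<dots> \<noteq> 0" using assms by (auto simp: prod_zero_iff)
  finally show ?thesis .
qed

text \<open>
  The points with coordinates \<open>g s v / q s\<close> form finitely many families, each given by rational
  functions of fewer than \<open>card V\<close> parameters; the lemma puts them on one hypersurface. The
  condition that a Lagrange form vanishes on the families is linear in its coefficients. There are
  \<open>D\<close> to the power \<open>card V\<close> coefficients, while it is enough to impose the condition on a grid in
  each parameter space, whose size grows only like a power of \<open>D\<close> with a smaller exponent.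
  Homogeneity avoids dividing by \<open>q s\<close>.
\<close>

lemma low_dimensional_image_in_hypersurface:
  fixes K :: "'s \<Rightarrow> 'k set" and V :: "'v set"
    and g :: "'s \<Rightarrow> 'v \<Rightarrow> ('k \<Rightarrow> real) \<Rightarrow> real" and q :: "'s \<Rightarrow> ('k \<Rightarrow> real) \<Rightarrow> real"
  assumes fin: "finite S" "finite V" "\<And>s. s \<in> S \<Longrightarrow> finite (K s)"
    and card: "\<And>s. s \<in> S \<Longrightarrow> card (K s) < card V"
    and g: "\<And>s v. s \<in> S \<Longrightarrow> v \<in> V \<Longrightarrow> sep_poly (K s) \<delta> (g s v)"
    and q: "\<And>s. s \<in> S \<Longrightarrow> sep_poly (K s) \<delta> (q s)"
  shows "\<exists>D c. (\<exists>T. lagrange_form V D c T 1 \<noteq> 0) \<and>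
    (\<forall>s\<in>S. \<forall>x. (\<forall>k. k \<notin> K s \<longrightarrow> x k = 0) \<longrightarrow> lagrange_form V D c (\<lambda>v. g s v x) (q s x) = 0)"
proof -
  define M where "M = card V"
  have M: "M \<ge> 1" if "S \<noteq> {}" using that card by (force simp: M_def)
  define B where "B = \<delta> * M + 1"
  \<comment> \<open>an interpolation degree for which the unknown coefficients outnumber the grid points\<close>
  define D where "D = card S * B ^ (M - 1) + 1"
  define \<epsilon> where "\<epsilon> = M * (D * \<delta>)"
  have D: "D \<ge> 1" by (simp add: D_def)
  have eps: "\<epsilon> + 1 \<le> B * D" using D by (simp add: \<epsilon>_def B_def algebra_simps)
  define E where "E = (V \<rightarrow>\<^sub>E {..<D})"
  define G where "G = Sigma S (\<lambda>s. K s \<rightarrow>\<^sub>E {..\<epsilon>})"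
  define pt where "pt = (\<lambda>s (e :: 'k \<Rightarrow> nat) k. if k \<in> K s then real (e k) else 0)"
  define P where "P = (\<lambda>s w x. \<Prod>v\<in>V. \<Prod>j\<in>{..<D} - {w v}. g s v x - real j * q s x)"
  have finE: "finite E" and cardE: "card E = D ^ M"
    using fin by (auto simp: E_def M_def card_PiE intro!: finite_PiE)
  have finG: "finite G" using fin by (auto simp: G_def intro!: finite_SigmaI finite_PiE)
  have "card G < card E"
  proof (cases "S \<noteq> {}")
    case True
    have "card G = (\<Sum>s\<in>S. (\<epsilon> + 1) ^ card (K s))"
      unfolding G_def using fin by (subst card_SigmaI) (auto simp: card_PiE intro!: finite_PiE)
    also have "\<dots> \<le> (\<Sum>s\<in>S. (B * D) ^ (M - 1))"
    proof (intro sum_mono)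
      fix s assume "s \<in> S"
      then have "card (K s) \<le> M - 1" using card[of s] by (simp add: M_def)
      then have "(\<epsilon> + 1) ^ card (K s) \<le> (\<epsilon> + 1) ^ (M - 1)" by (intro power_increasing) auto
      also have "\<dots> \<le> (B * D) ^ (M - 1)" using eps by (intro power_mono) auto
      finally show "(\<epsilon> + 1) ^ card (K s) \<le> (B * D) ^ (M - 1)" .
    qed
    also have "\<dots> = (card S * B ^ (M - 1)) * D ^ (M - 1)" by (simp add: power_mult_distrib)
    also have "\<dots> < D * D ^ (M - 1)" using D by (intro mult_strict_right_mono) (auto simp: D_def)
    also have "\<dots> = D ^ M" using M[OF True] by (cases M) auto
    finally show ?thesis by (simp add: cardE)
  next
    case False
    then show ?thesis using D by (simp add: G_def cardE)
  qed
  from homogeneous_system_nontrivial_solution[OF finG finE this,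
      of "\<lambda>w (s, e). P s w (pt s e)"]
  obtain c where c: "\<exists>w\<in>E. c w \<noteq> 0"
    "\<And>s e. s \<in> S \<Longrightarrow> e \<in> K s \<rightarrow>\<^sub>E {..\<epsilon>} \<Longrightarrow> (\<Sum>w\<in>E. c w * P s w (pt s e)) = 0"
    unfolding G_def by (fastforce simp: split_beta)
  have nz: "\<exists>T. lagrange_form V D c T 1 \<noteq> 0"
    using c(1) lagrange_form_at_node[OF fin(2)] unfolding E_def by blast
  have "lagrange_form V D c (\<lambda>v. g s v x) (q s x) = 0"
    if s: "s \<in> S" and x: "\<forall>k. k \<notin> K s \<longrightarrow> x k = 0" for s x
  proof -
    define f where "f = (\<lambda>x. lagrange_form V D c (\<lambda>v. g s v x) (q s x))"
    have f: "f x = (\<Sum>w\<in>E. c w * P s w x)" for x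
      by (simp add: f_def lagrange_form_def P_def E_def)
    have "sep_poly (K s) \<epsilon> (\<lambda>x. c w * P s w x)" if w: "w \<in> E" for w
    proof -
      have "sep_poly (K s) (D * \<delta>) (\<lambda>x. \<Prod>j\<in>{..<D} - {w v}. g s v x - real j * q s x)"
        if v: "v \<in> V" for v
      proof -
        have "sep_poly (K s) \<delta> (\<lambda>x. g s v x - real j * q s x)" for j
          using sep_poly_mult[OF sep_poly_const[of "K s" 0 "real j"] q[OF s]] g[OF s v]
          by (intro sep_poly_diff) auto
        then have "sep_poly (K s) (card ({..<D} - {w v}) * \<delta>)
            (\<lambda>x. \<Prod>j\<in>{..<D} - {w v}. g s v x - real j * q s x)"
          by (intro sep_poly_prod)
        moreover have "card ({..<D} - {w v}) \<le> D" by (metis Diff_subset card_lessThan card_mono finite_lessThan)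
        ultimately show ?thesis using sep_poly_mono mult_le_mono1 by blast
      qed
      then have "sep_poly (K s) \<epsilon> (P s w)" unfolding P_def \<epsilon>_def M_def by (intro sep_poly_prod)
      from sep_poly_mult[OF sep_poly_const[of "K s" 0 "c w"] this] show ?thesis by simp
    qed
    then have sp: "sep_poly (K s) \<epsilon> f" unfolding f by (intro sep_poly_sum)
    have "f x = 0"
    proof (rule sep_poly_zero_on_grid[OF fin(3)[OF s] sp])
      fix y assume y: "\<forall>v\<in>K s. \<exists>i\<le>\<epsilon>. y v = real i" "\<forall>v. v \<notin> K s \<longrightarrow> y v = x v"
      from y(1) obtain e where e: "\<And>v. v \<in> K s \<Longrightarrow> e v \<le> \<epsilon> \<and> y v = real (e v)" by metis
      have "y = pt s (restrict e (K s))" using e y(2) x by (auto simp: pt_def fun_eq_iff)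
      then show "f y = 0" using e by (simp add: f c(2)[OF s])
    qed
    then show ?thesis by (simp add: f_def)
  qed
  with nz show ?thesis by blast
qed

section \<open>Forms as multivariate polynomials\<close>

definition monom_eval :: "('v \<Rightarrow> real) \<Rightarrow> ('v \<Rightarrow>\<^sub>0 nat) \<Rightarrow> real" where
  "monom_eval p e = (\<Prod>v\<in>Poly_Mapping.keys e. p v ^ Poly_Mapping.lookup e v)"

lemma monom_eval_superset:
  assumes "finite A" "Poly_Mapping.keys e \<subseteq> A"
  shows "monom_eval p e = (\<Prod>v\<in>A. p v ^ Poly_Mapping.lookup e v)"
  unfolding monom_eval_def using assms
  by (intro prod.mono_neutral_left) (auto simp: in_keys_iff)

lemma monom_eval_add: "monom_eval p (e + e') = monom_eval p e * monom_eval p e'"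
proof -
  let ?A = "Poly_Mapping.keys e \<union> Poly_Mapping.keys e'"
  have "finite ?A" "Poly_Mapping.keys (e + e') \<subseteq> ?A"
    "Poly_Mapping.keys e \<subseteq> ?A" "Poly_Mapping.keys e' \<subseteq> ?A"
    using keys_add[of e e'] by auto
  then show ?thesis
    by (simp add: monom_eval_superset[of ?A] lookup_add power_add prod.distrib)
qed

lemma mpoly_eval_superset:
  assumes "finite A" "Poly_Mapping.keys f \<subseteq> A"
  shows "mpoly_eval p f = (\<Sum>e\<in>A. Poly_Mapping.lookup f e * monom_eval p e)"
  unfolding mpoly_eval_def monom_eval_def[symmetric] using assms
  by (intro sum.mono_neutral_left) (auto simp: in_keys_iff)

lemma mpoly_eval_zero: "mpoly_eval p 0 = 0"
  by (simp add: mpoly_eval_def)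

lemma mpoly_eval_add: "mpoly_eval p (f + g) = mpoly_eval p f + mpoly_eval p g"
proof -
  let ?A = "Poly_Mapping.keys f \<union> Poly_Mapping.keys g"
  have "finite ?A" "Poly_Mapping.keys (f + g) \<subseteq> ?A"
    "Poly_Mapping.keys f \<subseteq> ?A" "Poly_Mapping.keys g \<subseteq> ?A"
    using keys_add[of f g] by auto
  then show ?thesis
    by (simp add: mpoly_eval_superset[of ?A] lookup_add distrib_right sum.distrib)
qed

lemma mpoly_eval_sum: "mpoly_eval p (\<Sum>i\<in>I. f i) = (\<Sum>i\<in>I. mpoly_eval p (f i))"
  by (induction I rule: infinite_finite_induct) (auto simp: mpoly_eval_zero mpoly_eval_add)

lemma mpoly_eval_single: "mpoly_eval p (Poly_Mapping.single e c) = c * monom_eval p e"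
  by (simp add: mpoly_eval_def monom_eval_def)

lemma sum_monomials: "(\<Sum>e\<in>Poly_Mapping.keys f. Poly_Mapping.single e (Poly_Mapping.lookup f e)) = f"
  by (rule poly_mapping_eqI)
     (auto simp: lookup_sum lookup_single when_def in_keys_iff if_distrib cong: if_cong)

lemma mpoly_eval_mult: "mpoly_eval p (f * g) = mpoly_eval p f * mpoly_eval p g"
proof -
  have "f * g = (\<Sum>e\<in>Poly_Mapping.keys f. Poly_Mapping.single e (Poly_Mapping.lookup f e)) *
      (\<Sum>e'\<in>Poly_Mapping.keys g. Poly_Mapping.single e' (Poly_Mapping.lookup g e'))"
    by (simp only: sum_monomials)
  also have "\<dots> = (\<Sum>e\<in>Poly_Mapping.keys f. \<Sum>e'\<in>Poly_Mapping.keys g.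
      Poly_Mapping.single (e + e') (Poly_Mapping.lookup f e * Poly_Mapping.lookup g e'))"
    by (simp add: sum_product mult_single)
  finally have "mpoly_eval p (f * g) = (\<Sum>e\<in>Poly_Mapping.keys f. \<Sum>e'\<in>Poly_Mapping.keys g.
      (Poly_Mapping.lookup f e * Poly_Mapping.lookup g e') * (monom_eval p e * monom_eval p e'))"
    by (simp add: mpoly_eval_sum mpoly_eval_single monom_eval_add)
  also have "\<dots> = mpoly_eval p f * mpoly_eval p g"
    by (simp add: mpoly_eval_superset[OF finite_keys subset_refl] sum_product algebra_simps)
  finally show ?thesis .
qed

lemma mpoly_eval_one: "mpoly_eval p 1 = 1"
  using mpoly_eval_single[of p 0 1] by (simp add: monom_eval_def)

lemma mpoly_eval_prod: "mpoly_eval p (\<Prod>i\<in>I. f i) = (\<Prod>i\<in>I. mpoly_eval p (f i))"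
  by (induction I rule: infinite_finite_induct) (auto simp: mpoly_eval_one mpoly_eval_mult)

text \<open>
  The degree is a parameter, unlike in \<^const>\<open>mpoly_homogeneous\<close>, because a sum of homogeneous
  polynomials is homogeneous only if their degrees agree.
\<close>

definition form_in :: "'v set \<Rightarrow> nat \<Rightarrow> 'v real_mpoly \<Rightarrow> bool" where
  "form_in A k f \<longleftrightarrow> (\<forall>e\<in>Poly_Mapping.keys f. Poly_Mapping.keys e \<subseteq> A \<and>
     (\<Sum>v\<in>Poly_Mapping.keys e. Poly_Mapping.lookup e v) = k)"

lemma form_inD:
  assumes "form_in A k f"
  shows "mpoly_homogeneous f" "mpoly_vars f \<subseteq> A"
  using assms by (auto simp: form_in_def mpoly_homogeneous_def mpoly_vars_def)

lemma form_in_zero: "form_in A k 0"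
  by (simp add: form_in_def)

lemma form_in_one: "form_in A 0 1"
  by (simp add: form_in_def)

lemma form_in_add: "form_in A k f \<Longrightarrow> form_in A k g \<Longrightarrow> form_in A k (f + g)"
  unfolding form_in_def using keys_add[of f g] by blast

lemma form_in_sum: "(\<And>i. i \<in> I \<Longrightarrow> form_in A k (f i)) \<Longrightarrow> form_in A k (\<Sum>i\<in>I. f i)"
  by (induction I rule: infinite_finite_induct) (auto simp: form_in_zero form_in_add)

lemma form_in_mult:
  assumes "form_in A k f" "form_in A l g"
  shows "form_in A (k + l) (f * g)"
  unfolding form_in_def
proof
  have deg: "(\<Sum>v\<in>Poly_Mapping.keys e. Poly_Mapping.lookup e v) = (\<Sum>v\<in>B. Poly_Mapping.lookup e v)"
    if "finite B" "Poly_Mapping.keys e \<subseteq> B" for B and e :: "'a \<Rightarrow>\<^sub>0 nat"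
    using that by (intro sum.mono_neutral_left) (auto simp: in_keys_iff)
  fix e assume "e \<in> Poly_Mapping.keys (f * g)"
  then obtain a b where ab: "a \<in> Poly_Mapping.keys f" "b \<in> Poly_Mapping.keys g" "e = a + b"
    using keys_mult[of f g] by blast
  let ?B = "Poly_Mapping.keys a \<union> Poly_Mapping.keys b"
  have B: "finite ?B" "Poly_Mapping.keys (a + b) \<subseteq> ?B" "Poly_Mapping.keys a \<subseteq> ?B"
    "Poly_Mapping.keys b \<subseteq> ?B" using keys_add[of a b] by auto
  have "(\<Sum>v\<in>Poly_Mapping.keys a. Poly_Mapping.lookup a v) = k" "Poly_Mapping.keys a \<subseteq> A"
    "(\<Sum>v\<in>Poly_Mapping.keys b. Poly_Mapping.lookup b v) = l" "Poly_Mapping.keys b \<subseteq> A"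
    using assms ab by (auto simp: form_in_def)
  with B show "Poly_Mapping.keys e \<subseteq> A \<and>
     (\<Sum>v\<in>Poly_Mapping.keys e. Poly_Mapping.lookup e v) = k + l"
    unfolding ab(3) deg[OF B(1,2)] deg[OF B(1,3)] deg[OF B(1,4)]
    by (auto simp: lookup_add sum.distrib)
qed

lemma form_in_prod:
  assumes "\<And>i. i \<in> I \<Longrightarrow> form_in A (k i) (f i)"
  shows "form_in A (\<Sum>i\<in>I. k i) (\<Prod>i\<in>I. f i)"
  using assms
  by (induction I rule: infinite_finite_induct) (auto simp: form_in_one form_in_mult)

definition mpoly_const :: "real \<Rightarrow> 'v real_mpoly" where
  "mpoly_const c = Poly_Mapping.single 0 c"

definition mpoly_var :: "'v \<Rightarrow> 'v real_mpoly" where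
  "mpoly_var v = Poly_Mapping.single (Poly_Mapping.single v 1) 1"

lemma mpoly_eval_const: "mpoly_eval p (mpoly_const c) = c"
  by (simp add: mpoly_const_def mpoly_eval_single monom_eval_def)

lemma mpoly_eval_var: "mpoly_eval p (mpoly_var v) = p v"
  by (simp add: mpoly_var_def mpoly_eval_single monom_eval_def)

lemma form_in_const: "form_in A 0 (mpoly_const c)"
  by (simp add: mpoly_const_def form_in_def)

lemma form_in_var: "v \<in> A \<Longrightarrow> form_in A 1 (mpoly_var v)"
  by (simp add: mpoly_var_def form_in_def)

lemma lagrange_form_as_mpoly:
  assumes "ix ` V \<subseteq> A" "x0 \<in> A"
  shows "\<exists>f. form_in A (card V * (D - 1)) f \<and>
    (\<forall>p. mpoly_eval p f = lagrange_form V D c (\<lambda>v. p (ix v)) (p x0))"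
proof -
  define l where "l = (\<lambda>v j. mpoly_var (ix v) + mpoly_const (- real j) * mpoly_var x0)"
  define f where "f = (\<Sum>w \<in> V \<rightarrow>\<^sub>E {..<D}. mpoly_const (c w) * (\<Prod>v\<in>V. \<Prod>j\<in>{..<D} - {w v}. l v j))"
  have l: "form_in A 1 (l v j)" if "v \<in> V" for v j
    using form_in_mult[OF form_in_const form_in_var[OF assms(2)], of "- real j"]
      form_in_var[of "ix v" A] that assms(1)
    by (auto simp: l_def intro!: form_in_add)
  have "form_in A (card V * (D - 1)) f" unfolding f_def
  proof (rule form_in_sum)
    fix w assume w: "w \<in> V \<rightarrow>\<^sub>E {..<D}"
    have "form_in A (\<Sum>v\<in>V. \<Sum>j\<in>{..<D} - {w v}. 1) (\<Prod>v\<in>V. \<Prod>j\<in>{..<D} - {w v}. l v j)"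
      by (intro form_in_prod l)
    moreover have "(\<Sum>v\<in>V. \<Sum>j\<in>{..<D} - {w v}. 1) = (\<Sum>v\<in>V. D - 1)"
      using w by (intro sum.cong) (auto simp: card_Diff_singleton PiE_def Pi_def)
    ultimately show "form_in A (card V * (D - 1))
        (mpoly_const (c w) * (\<Prod>v\<in>V. \<Prod>j\<in>{..<D} - {w v}. l v j))"
      using form_in_mult[OF form_in_const, of A "card V * (D - 1)" _ "c w"] by simp
  qed
  moreover have "mpoly_eval p f = lagrange_form V D c (\<lambda>v. p (ix v)) (p x0)" for p
    by (simp add: f_def l_def lagrange_form_def mpoly_eval_sum mpoly_eval_mult mpoly_eval_prod
        mpoly_eval_add mpoly_eval_const mpoly_eval_var)
  ultimately show ?thesis by blast
qed

section \<open>Coordinates on symmetric matrices and bases of the column space\<close>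

text \<open>
  An arbitrary numbering of the indices, used to select one of the two positions \<open>(i, j)\<close> and \<open>(j,
  i)\<close>.
\<close>

definition pos_number :: "'n::finite \<Rightarrow> nat" where
  "pos_number = (SOME f. inj f)"

lemma inj_pos_number: "inj (pos_number :: 'n::finite \<Rightarrow> nat)"
proof -
  have "\<exists>f :: 'n \<Rightarrow> nat. inj f"
    using finite_imp_inj_to_nat_seg[of "UNIV :: 'n set"] by auto
  then show ?thesis unfolding pos_number_def by (rule someI_ex)
qed

definition upper :: "('n::finite \<times> 'n) set" where
  "upper = {(i, j). pos_number i \<le> pos_number j}"

definition upper_rep :: "'n::finite \<Rightarrow> 'n \<Rightarrow> 'n \<times> 'n" where
  "upper_rep i j = (if (i, j) \<in> upper then (i, j) else (j, i))"

lemma upper_total: "(i, j) \<in> upper \<or> (j, i) \<in> upper"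
  by (auto simp: upper_def)

lemma upper_antisym: "(i, j) \<in> upper \<Longrightarrow> (j, i) \<in> upper \<Longrightarrow> i = j"
  using inj_pos_number by (auto simp: upper_def inj_def)

lemma upper_refl: "(i, i) \<in> upper"
  by (simp add: upper_def)

lemma upper_rep_in_upper: "upper_rep i j \<in> upper"
  using upper_total[of i j] by (auto simp: upper_rep_def)

lemma upper_rep_commute: "upper_rep i j = upper_rep j i"
  using upper_total[of i j] upper_antisym[of i j] by (auto simp: upper_rep_def)

lemma upper_rep_of_upper: "p \<in> upper \<Longrightarrow> upper_rep (fst p) (snd p) = p"
  by (auto simp: upper_rep_def)

text \<open>
  The pairs in \<open>W \<times> W\<close> are covered by the selected positions and their transposes, which overlap
  in the diagonal.
\<close>

lemma card_upper_square: "card (upper \<inter> W \<times> W) = (card W + 1) choose 2"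
  for W :: "'n::finite set"
proof -
  let ?U = "upper \<inter> W \<times> W" and ?D = "(\<lambda>i. (i, i)) ` W"
  have U: "?U \<union> prod.swap ` ?U = W \<times> W" "?U \<inter> prod.swap ` ?U = ?D"
  proof -
    show "?U \<union> prod.swap ` ?U = W \<times> W"
    proof (intro equalityI subsetI)
      fix p assume p: "p \<in> W \<times> W"
      obtain i j where ij: "p = (i, j)" by (cases p)
      show "p \<in> ?U \<union> prod.swap ` ?U"
      proof (cases "(i, j) \<in> upper")
        case False
        then have "(j, i) \<in> ?U" using upper_total[of i j] p ij by blast
        then show ?thesis using ij by (metis UnI2 image_eqI swap_simp)
      qed (use p ij in blast)
    qed auto
    show "?U \<inter> prod.swap ` ?U = ?D"
    proof (intro equalityI subsetI)
      fix p assume "p \<in> ?D"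
      then obtain i where "p = (i, i)" "(i, i) \<in> ?U" using upper_refl by auto
      then show "p \<in> ?U \<inter> prod.swap ` ?U" by (metis IntI image_eqI swap_simp)
    next
      fix p assume "p \<in> ?U \<inter> prod.swap ` ?U"
      then obtain i j where "p = (i, j)" "(i, j) \<in> upper" "(j, i) \<in> upper" "i \<in> W" by auto
      then show "p \<in> ?D" using upper_antisym[of i j] by blast
    qed
  qed
  have "card ?U + card (prod.swap ` ?U) = card (W \<times> W) + card ?D"
    using card_Un_Int[of ?U "prod.swap ` ?U"] unfolding U by simp
  moreover have "card (prod.swap ` ?U) = card ?U" "card ?D = card W"
    by (auto intro!: card_image simp: inj_on_def)
  ultimately have "2 * card ?U = card W * card W + card W" by (simp add: card_cartesian_product)
  moreover have "2 * ((card W + 1) choose 2) = card W * card W + card W"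
    by (simp add: choose_two algebra_simps)
  ultimately show ?thesis by simp
qed

lemma card_upper: "card (upper :: ('n::finite \<times> 'n) set) = (CARD('n) + 1) choose 2"
  using card_upper_square[of "UNIV :: 'n set"] by simp

lemma sym_matsD: "A \<in> sym_mats \<Longrightarrow> A $ i $ j = A $ j $ i"
  by (unfold sym_mats_def, drule CollectD) (simp add: transpose_def vec_eq_iff)

lemma sym_matsI: "(\<And>i j. A $ i $ j = A $ j $ i) \<Longrightarrow> A \<in> sym_mats"
  by (simp add: sym_mats_def transpose_def vec_eq_iff)

lemma sym_upper_rep: "A \<in> sym_mats \<Longrightarrow> A $ fst (upper_rep i j) $ snd (upper_rep i j) = A $ i $ j"
  by (cases "(i, j) \<in> upper") (auto simp: upper_rep_def intro: sym_matsD)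

text \<open>
  The columns of \<open>A\<close> with index in \<open>W\<close> are a basis of the column space, indexed without
  repetition, and the rows \<open>W\<close> of \<open>U\<close> hold the coordinates of all columns in that basis.
\<close>

definition column_basis :: "real ^ 'n ^ 'n \<Rightarrow> 'n set \<Rightarrow> ('n \<Rightarrow> 'n \<Rightarrow> real) \<Rightarrow> bool" where
  "column_basis A W U \<longleftrightarrow>
     (\<forall>y. (\<forall>j. (\<Sum>k\<in>W. A $ j $ k * y k) = 0) \<longrightarrow> (\<forall>k\<in>W. y k = 0)) \<and>
     (\<forall>i j. A $ j $ i = (\<Sum>k\<in>W. A $ j $ k * U k i)) \<and>
     (\<forall>k\<in>W. \<forall>i\<in>W. U k i = (if k = i then 1 else 0))"

lemma column_basisD:
  assumes "column_basis A W U"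
  shows "(\<And>j. (\<Sum>k\<in>W. A $ j $ k * y k) = 0) \<Longrightarrow> k \<in> W \<Longrightarrow> y k = 0"
    and "A $ j $ i = (\<Sum>k\<in>W. A $ j $ k * U k i)"
    and "k \<in> W \<Longrightarrow> i \<in> W \<Longrightarrow> U k i = (if k = i then 1 else 0)"
  using assms unfolding column_basis_def by blast+

lemma column_basis_exists:
  fixes A :: "real ^ 'n ^ 'n"
  shows "\<exists>W U. column_basis A W U"
proof -
  define ind where "ind = (\<lambda>W :: 'n set. \<forall>y. (\<forall>j. (\<Sum>k\<in>W. A $ j $ k * y k) = 0) \<longrightarrow> (\<forall>k\<in>W. y k = 0))"
  have "ind {}" by (simp add: ind_def)
  then obtain W where W: "ind W" "\<And>W'. ind W' \<Longrightarrow> W \<subseteq> W' \<Longrightarrow> W = W'"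
    using finite_has_maximal[of "{W. ind W}"] by auto
  have "\<exists>u. (\<forall>j. A $ j $ i = (\<Sum>k\<in>W. A $ j $ k * u k)) \<and>
     (i \<in> W \<longrightarrow> (\<forall>k\<in>W. u k = (if k = i then 1 else 0)))" for i
  proof (cases "i \<in> W")
    case True
    then show ?thesis by (intro exI[of _ "\<lambda>k. if k = i then 1 else 0"]) (simp add: if_distrib cong: if_cong)
  next
    case False
    then have "\<not> ind (insert i W)" using W(2)[of "insert i W"] by blast
    then obtain y where y: "\<And>j. (\<Sum>k\<in>insert i W. A $ j $ k * y k) = 0" "\<exists>k\<in>insert i W. y k \<noteq> 0"
      unfolding ind_def by blast
    have y': "A $ j $ i * y i + (\<Sum>k\<in>W. A $ j $ k * y k) = 0" for j using y(1)[of j] False by simp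
    have yi: "y i \<noteq> 0"
    proof
      assume 0: "y i = 0"
      then have "\<forall>k\<in>W. y k = 0" using y' W(1) unfolding ind_def by simp
      with 0 y(2) show False by auto
    qed
    have "A $ j $ i = (\<Sum>k\<in>W. A $ j $ k * (- y k / y i))" for j
    proof -
      have "(\<Sum>k\<in>W. A $ j $ k * (- y k / y i)) = (\<Sum>k\<in>W. A $ j $ k * y k) * (- 1 / y i)"
        unfolding sum_distrib_right by (intro sum.cong) auto
      also have "\<dots> = A $ j $ i" using y'[of j] yi by (simp add: field_simps)
      finally show ?thesis by simp
    qed
    then show ?thesis using False by (intro exI[of _ "\<lambda>k. - y k / y i"]) auto
  qed
  then obtain u where u: "\<And>i j. A $ j $ i = (\<Sum>k\<in>W. A $ j $ k * u i k)"
     "\<And>i k. i \<in> W \<Longrightarrow> k \<in> W \<Longrightarrow> u i k = (if k = i then 1 else 0)" by metis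
  then have "column_basis A W (\<lambda>k i. u i k)"
    using W(1) unfolding column_basis_def ind_def by blast
  then show ?thesis by blast
qed

text \<open>
  \<open>A\<close> is the product of its columns in \<open>W\<close>, an injective matrix, with the rows \<open>W\<close> of \<open>U\<close>.
\<close>

lemma column_basis_kernel:
  assumes "column_basis A W U"
  shows "A *v x = 0 \<longleftrightarrow> (\<forall>k\<in>W. (\<Sum>i\<in>UNIV. U k i * x $ i) = 0)"
proof -
  have Ax: "(A *v x) $ j = (\<Sum>k\<in>W. A $ j $ k * (\<Sum>i\<in>UNIV. U k i * x $ i))" for j
  proof -
    have "(A *v x) $ j = (\<Sum>i\<in>UNIV. A $ j $ i * x $ i)" by (simp add: matrix_vector_mult_def)
    also have "\<dots> = (\<Sum>i\<in>UNIV. (\<Sum>k\<in>W. A $ j $ k * U k i) * x $ i)"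
      by (intro sum.cong refl arg_cong2[of _ _ _ _ "(*)"] column_basisD(2)[OF assms])
    also have "\<dots> = (\<Sum>i\<in>UNIV. \<Sum>k\<in>W. A $ j $ k * (U k i * x $ i))"
      by (simp add: sum_distrib_right mult.assoc)
    also have "\<dots> = (\<Sum>k\<in>W. \<Sum>i\<in>UNIV. A $ j $ k * (U k i * x $ i))" by (rule sum.swap)
    finally show ?thesis by (simp add: sum_distrib_left)
  qed
  show ?thesis
  proof
    assume "A *v x = 0"
    then have "\<forall>j. (\<Sum>k\<in>W. A $ j $ k * (\<Sum>i\<in>UNIV. U k i * x $ i)) = 0" by (simp add: Ax[symmetric])
    then show "\<forall>k\<in>W. (\<Sum>i\<in>UNIV. U k i * x $ i) = 0"
      using column_basisD(1)[OF assms, of "\<lambda>k. \<Sum>i\<in>UNIV. U k i * x $ i"] by blast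
  qed (simp add: vec_eq_iff Ax)
qed

lemma column_basis_row_sum:
  fixes A :: "real ^ 'n ^ 'n"
  assumes "column_basis A W U" "k \<in> W"
  shows "(\<Sum>i\<in>UNIV. U k i * x i) = x k + (\<Sum>i\<in>-W. U k i * x i)"
proof -
  have "(\<Sum>i\<in>UNIV. U k i * x i) = (\<Sum>i\<in>W. U k i * x i) + (\<Sum>i\<in>-W. U k i * x i)"
    by (subst sum.union_disjoint[symmetric]) (auto intro: sum.cong)
  also have "(\<Sum>i\<in>W. U k i * x i) = (\<Sum>i\<in>W. if k = i then x i else 0)"
    by (intro sum.cong refl) (simp add: column_basisD(3)[OF assms(1,2)])
  also have "\<dots> = x k" using assms(2) by simp
  finally show ?thesis .
qed

lemma card_column_basis:
  fixes A :: "real ^ 'n ^ 'n"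
  assumes "column_basis A W U"
  shows "card W = rank A"
proof -
  let ?c = "\<lambda>k. Finite_Cartesian_Product.column k A"
  have ind: "\<forall>k\<in>W. y k = 0" if "(\<Sum>k\<in>W. y k *\<^sub>R ?c k) = 0" for y
  proof -
    have "(\<Sum>k\<in>W. A $ j $ k * y k) = (\<Sum>k\<in>W. y k *\<^sub>R ?c k) $ j" for j
      by (simp add: column_def mult.commute)
    then have "(\<Sum>k\<in>W. A $ j $ k * y k) = 0" for j using that by simp
    then show ?thesis using column_basisD(1)[OF assms, of y] by blast
  qed
  have inj: "inj_on ?c W"
  proof (rule inj_onI, rule ccontr)
    fix k l assume kl: "k \<in> W" "l \<in> W" "?c k = ?c l" "k \<noteq> l"
    let ?y = "\<lambda>i. if i = k then 1 else if i = l then - 1 else (0::real)"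
    have "(\<Sum>i\<in>W. ?y i *\<^sub>R ?c i) = (\<Sum>i\<in>{k, l}. ?y i *\<^sub>R ?c i)"
      using kl by (intro sum.mono_neutral_right) auto
    also have "\<dots> = 0" using kl by simp
    finally show False using ind[of ?y] kl(1) by force
  qed
  have "independent (?c ` W)"
  proof (rule independent_if_scalars_zero)
    fix f v assume f: "(\<Sum>v\<in>?c ` W. f v *\<^sub>R v) = 0" "v \<in> ?c ` W"
    then have "(\<Sum>k\<in>W. f (?c k) *\<^sub>R ?c k) = 0" by (simp add: sum.reindex[OF inj])
    from ind[OF this] f(2) show "f v = 0" by auto
  qed simp
  moreover have "columns A \<subseteq> span (?c ` W)"
  proof
    fix v assume "v \<in> columns A"
    then obtain i where "v = ?c i" by (auto simp: columns_def)
    also have "?c i = (\<Sum>k\<in>W. U k i *\<^sub>R ?c k)"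
      using column_basisD(2)[OF assms, of _ i] by (simp add: vec_eq_iff column_def mult.commute)
    also have "\<dots> \<in> span (?c ` W)" by (intro span_sum span_scale span_base) auto
    finally show "v \<in> span (?c ` W)" .
  qed
  moreover have "?c ` W \<subseteq> columns A" by (auto simp: columns_def)
  ultimately have "dim (columns A) = card (?c ` W)"
    using dim_unique[of "?c ` W" "columns A" "card (?c ` W)"] by simp
  then show ?thesis by (simp add: column_rank_def card_image[OF inj])
qed

section \<open>Boundary points of the semidefinite cone in a linear space\<close>

text \<open>
  The symmetric \<open>C\<close> with \<open>A ** C = 0\<close> form the normal space at \<open>A\<close> of the manifold of symmetric
  matrices of the same rank as \<open>A\<close>. So this says that \<open>L\<close> meets one of these manifolds
  nontransversally outside the origin.
\<close>

definition rank_degenerate :: "(real ^ 'n ^ 'n) set \<Rightarrow> bool" where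
  "rank_degenerate L \<longleftrightarrow>
     (\<exists>A\<in>L. A \<noteq> 0 \<and> (\<exists>C\<in>sym_mats. C \<noteq> 0 \<and> A ** C = 0 \<and> (\<forall>B\<in>L. B \<bullet> C = 0)))"

lemma sym_inner_commute: "A \<in> sym_mats \<Longrightarrow> x \<bullet> (A *v y) = y \<bullet> (A *v x)"
  using dot_lmul_matrix[of x A y] transpose_matrix_vector[of A x]
  by (simp add: sym_mats_def inner_commute)

lemma matrix_diff_scaleR_vector: "(B - t *\<^sub>R A) *v x = B *v x - t *\<^sub>R (A *v x)"
  for A B :: "real ^ 'n ^ 'm"
  by (simp add: matrix_vector_mult_diff_rdistrib scaleR_matrix_vector_assoc)

lemma sym_mats_subspace: "subspace sym_mats"
  by (auto simp: subspace_def sym_mats_def transpose_def vec_eq_iff)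

lemma kernel_subspace: "subspace {x. A *v x = 0}" for A :: "real ^ 'n ^ 'm"
  by (auto simp: subspace_def matrix_vector_right_distrib matrix_vector_mult_scaleR)

lemma rank_plus_nullity: "rank A + dim {x. A *v x = 0} = CARD('n)" for A :: "real ^ 'n ^ 'm"
proof -
  have row: "(A *v x) $ i = Finite_Cartesian_Product.row i A \<bullet> x" for x i
    by (simp add: matrix_vector_mult_def inner_vec_def row_def)
  have "{x. A *v x = 0} = {x \<in> UNIV. \<forall>y\<in>span (rows A). orthogonal y x}"
  proof (intro equalityI subsetI)
    fix x assume "x \<in> {x. A *v x = 0}"
    then show "x \<in> {x \<in> UNIV. \<forall>y\<in>span (rows A). orthogonal y x}"
      using orthogonal_nullspace_rowspace[of A x] orthogonal_commute by blast
  next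
    fix x assume x: "x \<in> {x \<in> UNIV. \<forall>y\<in>span (rows A). orthogonal y x}"
    have "(A *v x) $ i = 0" for i
    proof -
      have "Finite_Cartesian_Product.row i A \<in> span (rows A)" by (intro span_base) (auto simp: rows_def)
      then show ?thesis using x by (auto simp: row orthogonal_def)
    qed
    then show "x \<in> {x. A *v x = 0}" by (simp add: vec_eq_iff)
  qed
  then show ?thesis
    using dim_subspace_orthogonal_to_vectors[of "span (rows A)" UNIV]
    by (simp add: row_rank_def)
qed

lemma rank_less_if_kernel_larger:
  fixes A B :: "real ^ 'n ^ 'm"
  assumes "\<And>x. A *v x = 0 \<Longrightarrow> B *v x = 0" "B *v z = 0" "A *v z \<noteq> 0"
  shows "rank B < rank A"
proof -
  have "{x. A *v x = 0} \<subset> {x. B *v x = 0}" using assms by auto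
  then have "dim {x. A *v x = 0} < dim {x. B *v x = 0}"
    by (intro dim_psubset) (simp add: span_eq_iff[THEN iffD2, OF kernel_subspace])
  then show ?thesis using rank_plus_nullity[of A] rank_plus_nullity[of B] by linarith
qed

text \<open>
  Otherwise the quadratic form of \<open>A\<close> would take negative values at \<open>x + t A x\<close> for a small \<open>t <
  0\<close>.
\<close>

lemma psd_isotropic_in_kernel:
  assumes "positive_semidefinite A" "x \<bullet> (A *v x) = 0"
  shows "A *v x = 0"
proof (rule ccontr)
  assume nz: "A *v x \<noteq> 0"
  have sym: "A \<in> sym_mats" and psd: "\<And>x. x \<bullet> (A *v x) \<ge> 0"
    using assms by (auto simp: positive_semidefinite_def)
  define y where "y = A *v x"
  define q where "q = y \<bullet> (A *v y)"
  have a: "y \<bullet> y > 0" using nz by (simp add: y_def)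
  have exp: "2 * t * (y \<bullet> y) + t * t * q \<ge> 0" for t
  proof -
    have "(x + t *\<^sub>R y) \<bullet> (A *v (x + t *\<^sub>R y)) = 2 * t * (y \<bullet> y) + t * t * q"
      using assms(2) sym_inner_commute[OF sym, of x y]
      by (simp add: matrix_vector_right_distrib matrix_vector_mult_scaleR inner_add_left
          inner_add_right q_def algebra_simps) (simp add: y_def)
    then show ?thesis using psd[of "x + t *\<^sub>R y"] by simp
  qed
  show False
  proof (cases "q = 0")
    case True
    then show ?thesis using exp[of "-1"] a by simp
  next
    case False
    then have q: "q > 0" using psd[of y] by (simp add: q_def)
    have "2 * (- ((y \<bullet> y) / q)) * (y \<bullet> y) + (- ((y \<bullet> y) / q)) * (- ((y \<bullet> y) / q)) * q
        = - ((y \<bullet> y) * (y \<bullet> y) / q)"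
      using q by (simp add: field_simps)
    moreover have "(y \<bullet> y) * (y \<bullet> y) / q > 0" using a q by simp
    ultimately show False using exp[of "- ((y \<bullet> y) / q)"] by linarith
  qed
qed

text \<open>
  Take for \<open>t\<close> the minimum of the quotient of the two quadratic forms on the unit sphere of the
  orthogonal complement of the kernel of \<open>A\<close>, where the form of \<open>A\<close> is positive. Then \<open>B - t A\<close> is
  PSD, and it annihilates the kernel of \<open>A\<close> and in addition a vector at which the minimum is
  attained.
\<close>

lemma psd_boundary_in_pencil:
  fixes A B :: "real ^ 'n ^ 'n"
  assumes A: "positive_semidefinite A" "A \<noteq> 0" and B: "B \<in> sym_mats"
    and ker: "\<And>x. A *v x = 0 \<Longrightarrow> B *v x = 0"
  shows "\<exists>t. positive_semidefinite (B - t *\<^sub>R A) \<and> rank (B - t *\<^sub>R A) < rank A"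
proof -
  have symA: "A \<in> sym_mats" and psd: "\<And>x. x \<bullet> (A *v x) \<ge> 0"
    using A by (auto simp: positive_semidefinite_def)
  define N where "N = {x. A *v x = 0}"
  have N: "subspace N" "span N = N" by (simp_all add: N_def kernel_subspace span_eq_iff[THEN iffD2, OF kernel_subspace])
  define O' where "O' = {y. \<forall>x\<in>N. orthogonal x y}"
  have subO: "subspace O'" unfolding O'_def by (auto simp: subspace_def orthogonal_clauses)
  define S where "S = sphere 0 1 \<inter> O'"
  have compS: "compact S" unfolding S_def
    by (intro compact_Int_closed compact_sphere closed_subspace subO)
  have posA: "y \<bullet> (A *v y) > 0" if "y \<in> O'" "y \<noteq> 0" for y
  proof (rule ccontr)
    assume "\<not> y \<bullet> (A *v y) > 0"
    then have "y \<bullet> (A *v y) = 0" using psd[of y] by simp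
    then have "y \<in> N" using psd_isotropic_in_kernel[OF A(1)] by (simp add: N_def)
    then have "orthogonal y y" using that by (auto simp: O'_def)
    then show False using that by (simp add: orthogonal_self)
  qed
  have decomp: "\<exists>y z. x = y + z \<and> y \<in> N \<and> z \<in> O'" for x
  proof -
    obtain y z where "y \<in> span N" "\<And>w. w \<in> span N \<Longrightarrow> orthogonal z w" "x = y + z"
      using orthogonal_subspace_decomp_exists[of N x] by blast
    then show ?thesis using N orthogonal_commute unfolding O'_def by blast
  qed
  obtain x where "A *v x \<noteq> 0" using A(2) by (metis matrix_eq matrix_vector_mult_0)
  moreover obtain y z where yz: "x = y + z" "y \<in> N" "z \<in> O'" using decomp by blast
  ultimately have "z \<noteq> 0" by (auto simp: N_def)
  then have "z /\<^sub>R norm z \<in> S" using yz subspace_scale[OF subO] by (auto simp: S_def)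
  then have neS: "S \<noteq> {}" by blast
  define h where "h = (\<lambda>y. (y \<bullet> (B *v y)) / (y \<bullet> (A *v y)))"
  have S: "y \<in> O'" "y \<noteq> 0" if "y \<in> S" for y using that by (auto simp: S_def)
  have "continuous_on S h" unfolding h_def
  proof (intro continuous_on_divide continuous_on_inner continuous_on_id
      matrix_vector_mult_linear_continuous_on ballI)
    fix y assume "y \<in> S"
    then show "y \<bullet> (A *v y) \<noteq> 0" using posA[OF S] by force
  qed
  from continuous_attains_inf[OF compS neS this]
  obtain x0 where x0: "x0 \<in> S" "\<And>y. y \<in> S \<Longrightarrow> h x0 \<le> h y" by blast
  let ?M = "B - h x0 *\<^sub>R A"
  have symM: "?M \<in> sym_mats"
    using subspace_diff[OF sym_mats_subspace B subspace_scale[OF sym_mats_subspace symA]] .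
  have quad: "v \<bullet> (?M *v v) = v \<bullet> (B *v v) - h x0 * (v \<bullet> (A *v v))" for v
    by (simp add: matrix_diff_scaleR_vector inner_diff_right)
  have "x \<bullet> (?M *v x) \<ge> 0" for x
  proof -
    obtain y z where yz: "x = y + z" "y \<in> N" "z \<in> O'" using decomp by blast
    have "?M *v y = 0" using yz(2) ker by (simp add: matrix_diff_scaleR_vector N_def)
    then have red: "x \<bullet> (?M *v x) = z \<bullet> (?M *v z)"
      unfolding yz(1) using sym_inner_commute[OF symM, of y z]
      by (simp add: matrix_vector_right_distrib inner_add_left)
    show ?thesis
    proof (cases "z = 0")
      case False
      define w where "w = z /\<^sub>R norm z"
      have w: "w \<in> S" using yz subspace_scale[OF subO] False by (auto simp: S_def w_def)
      have "h x0 \<le> h w" by (rule x0(2)[OF w])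
      then have "h x0 * (w \<bullet> (A *v w)) \<le> w \<bullet> (B *v w)"
        using posA[OF S[OF w]] pos_le_divide_eq[of "w \<bullet> (A *v w)" "h x0" "w \<bullet> (B *v w)"]
        by (simp add: h_def[THEN fun_cong, of w])
      then have "0 \<le> w \<bullet> (?M *v w)" unfolding quad by simp
      moreover have "z = norm z *\<^sub>R w" using False by (simp add: w_def)
      then have "z \<bullet> (?M *v z) = norm z * norm z * (w \<bullet> (?M *v w))"
        using matrix_vector_mult_scaleR[of ?M "norm z" w]
        by (metis (no_types, lifting) inner_scaleR_left inner_scaleR_right mult.assoc)
      ultimately show ?thesis unfolding red by simp
    qed (simp add: red)
  qed
  then have psdM: "positive_semidefinite ?M" using symM by (simp add: positive_semidefinite_def)
  have "x0 \<bullet> (?M *v x0) = 0" unfolding quad using posA[OF S[OF x0(1)]] by (simp add: h_def)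
  from psd_isotropic_in_kernel[OF psdM this] have "?M *v x0 = 0" .
  moreover have "A *v x0 \<noteq> 0" using posA[OF S[OF x0(1)]] by auto
  ultimately have "rank ?M < rank A"
    by (intro rank_less_if_kernel_larger[of A ?M x0]) (simp_all add: matrix_diff_scaleR_vector ker)
  with psdM show ?thesis by blast
qed

text \<open>
  For symmetric \<open>B\<close>, vanishing on the kernel of \<open>A\<close> amounts to one linear condition for each
  position that is not in the block \<open>W \<times> W\<close>. One more condition, the vanishing of an entry at
  which \<open>A\<close> does not vanish, excludes the multiples of \<open>A\<close>.
\<close>

lemma linear_conditions_on_kernel:
  fixes A :: "real ^ 'n ^ 'n"
  assumes W: "column_basis A W U" and L: "subspace L" "L \<subseteq> sym_mats" and "A \<noteq> 0"
    and card: "card (upper - W \<times> W) + 1 < dim L"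
  shows "\<exists>B\<in>L. (\<forall>x. A *v x = 0 \<longrightarrow> B *v x = 0) \<and> (\<forall>t. B \<noteq> t *\<^sub>R A)"
proof -
  obtain i0 j0 where A0: "A $ i0 $ j0 \<noteq> 0" using \<open>A \<noteq> 0\<close> by (auto simp: vec_eq_iff)
  obtain Bs where Bs: "Bs \<subseteq> L" "independent Bs" "card Bs = dim L"
    using basis_exists[of L] by metis
  have finBs: "finite Bs" using Bs independent_imp_finite by blast
  \<comment> \<open>a basis of the whole space whose members outside \<open>W\<close> form a basis of the kernel of \<open>A\<close>\<close>
  define z where "z = (\<lambda>i. if i \<in> W then axis i 1 else
     (\<chi> k. if k = i then 1 else if k \<in> W then - U k i else 0))"
  define G where "G = Some ` (upper - W \<times> W) \<union> {None}"
  define h where "h = (\<lambda>(b :: real^'n^'n) g. case g of None \<Rightarrow> b $ i0 $ j0 | Some (i, j) \<Rightarrow> z i \<bullet> (b *v z j))"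
  have "card G = card (upper - W \<times> W) + 1"
    unfolding G_def by (subst card_Un_disjoint) (auto simp: card_image)
  then have "card G < card Bs" "finite G" using card Bs(3) by (simp_all add: G_def)
  from homogeneous_system_nontrivial_solution[OF this(2) finBs this(1), of h]
  obtain c where c: "\<exists>b\<in>Bs. c b \<noteq> 0" "\<And>g. g \<in> G \<Longrightarrow> (\<Sum>b\<in>Bs. c b * h b g) = 0" by blast
  define B where "B = (\<Sum>b\<in>Bs. c b *\<^sub>R b)"
  have BL: "B \<in> L" unfolding B_def using Bs(1) L(1)
    by (intro subspace_sum subspace_scale) auto
  have "B \<noteq> 0"
  proof
    assume "B = 0"
    then have "\<forall>b\<in>Bs. c b = 0"
      using Bs(2) unfolding dependent_finite[OF finBs] B_def by blast
    with c(1) show False by blast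
  qed
  have symB: "B \<in> sym_mats" using BL L(2) by blast
  have "B $ i0 $ j0 = 0" using c(2)[of None] by (simp add: B_def G_def h_def)
  then have nomult: "B \<noteq> t *\<^sub>R A" for t using A0 \<open>B \<noteq> 0\<close>
    by auto
  have Bv: "x \<bullet> (B *v y) = (\<Sum>b\<in>Bs. c b * (x \<bullet> (b *v y)))" for x y
  proof -
    have "B *v y = (\<Sum>b\<in>Bs. c b *\<^sub>R (b *v y))" unfolding B_def
      by (induction Bs rule: infinite_finite_induct)
         (auto simp: matrix_vector_mult_add_rdistrib scaleR_matrix_vector_assoc)
    then show ?thesis by (simp add: inner_sum_right)
  qed
  have zBz: "z i \<bullet> (B *v z j) = 0" if "j \<notin> W" for i j
  proof (cases "(i, j) \<in> upper")
    case True
    then show ?thesis using c(2)[of "Some (i, j)"] that by (simp add: G_def h_def Bv)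
  next
    case False
    then have "(j, i) \<in> upper" using upper_total by blast
    then have "z j \<bullet> (B *v z i) = 0" using c(2)[of "Some (j, i)"] that by (simp add: G_def h_def Bv)
    then show ?thesis using sym_inner_commute[OF symB] by simp
  qed
  have Bz: "B *v z j = 0" if j: "j \<notin> W" for j
  proof -
    let ?u = "B *v z j"
    have uW: "?u $ i = 0" if "i \<in> W" for i
      using zBz[OF j, of i] that by (simp add: z_def inner_axis' )
    have "?u $ i = 0" if i: "i \<notin> W" for i
    proof -
      have "z i \<bullet> ?u = (\<Sum>k\<in>UNIV. if k = i then ?u $ k else 0)"
        unfolding inner_vec_def using i uW by (intro sum.cong) (auto simp: z_def)
      also have "\<dots> = ?u $ i" by simp
      finally show ?thesis using zBz[OF j, of i] by simp
    qed
    with uW show ?thesis by (auto simp: vec_eq_iff)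
  qed
  have "B *v x = 0" if x: "A *v x = 0" for x
  proof -
    have xk: "x $ k = (\<Sum>i\<in>-W. - U k i * x $ i)" if "k \<in> W" for k
    proof -
      have "x $ k + (\<Sum>i\<in>-W. U k i * x $ i) = 0"
        using x that column_basis_row_sum[OF W that, of "\<lambda>i. x $ i"]
        unfolding column_basis_kernel[OF W] by simp
      then show ?thesis by (simp add: sum_negf eq_neg_iff_add_eq_0)
    qed
    have "x = (\<Sum>i\<in>-W. x $ i *\<^sub>R z i)"
    proof (subst vec_eq_iff, intro allI)
      fix k
      show "x $ k = (\<Sum>i\<in>-W. x $ i *\<^sub>R z i) $ k"
      proof (cases "k \<in> W")
        case True
        then have "(\<Sum>i\<in>-W. x $ i *\<^sub>R z i) $ k = (\<Sum>i\<in>-W. - U k i * x $ i)"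
          by (auto simp: z_def intro!: sum.cong)
        then show ?thesis using xk[OF True] by simp
      next
        case False
        have "(\<Sum>i\<in>-W. x $ i *\<^sub>R z i) $ k = (\<Sum>i\<in>-W. (x $ i *\<^sub>R z i) $ k)" by simp
        also have "\<dots> = (\<Sum>i\<in>-W. if i = k then x $ i else 0)"
          by (rule sum.cong) (use False in \<open>auto simp: z_def\<close>)
        finally show ?thesis using False by simp
      qed
    qed
    then have "B *v x = B *v (\<Sum>i\<in>-W. x $ i *\<^sub>R z i)" by simp
    also have "\<dots> = (\<Sum>i\<in>-W. x $ i *\<^sub>R (B *v z i))"
      by (simp add: linear_sum[OF matrix_vector_mul_linear] matrix_vector_mult_scaleR)
    also have "\<dots> = 0" using Bz by (intro sum.neutral) auto
    finally show ?thesis .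
  qed
  with BL nomult show ?thesis by blast
qed

section \<open>Transversality to the rank strata\<close>

definition outer :: "real ^ 'n \<Rightarrow> real ^ 'n ^ 'n" where
  "outer v = (\<chi> i j. v $ i * v $ j)"

lemma outer_vector: "outer v *v x = (v \<bullet> x) *\<^sub>R v"
  by (simp add: outer_def matrix_vector_mult_def inner_vec_def vec_eq_iff sum_distrib_left
      algebra_simps)

lemma sym_outer: "outer v \<in> sym_mats"
  by (rule sym_matsI) (simp add: outer_def)

lemma psd_plus_outer:
  assumes A: "positive_semidefinite A" and e: "e > 0"
  shows "positive_semidefinite (A + e *\<^sub>R outer v)"
    and "(A + e *\<^sub>R outer v) *v x = 0 \<longleftrightarrow> A *v x = 0 \<and> v \<bullet> x = 0"
proof -
  have sym: "A \<in> sym_mats" and psd: "\<And>x. x \<bullet> (A *v x) \<ge> 0"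
    using A by (auto simp: positive_semidefinite_def)
  have val: "(A + e *\<^sub>R outer v) *v x = A *v x + (e * (v \<bullet> x)) *\<^sub>R v" for x
    by (simp add: matrix_vector_mult_add_rdistrib scaleR_matrix_vector_assoc[symmetric] outer_vector)
  have quad: "x \<bullet> ((A + e *\<^sub>R outer v) *v x) = x \<bullet> (A *v x) + e * ((v \<bullet> x) * (v \<bullet> x))" for x
    by (simp add: val inner_add_right inner_commute)
  have nn: "e * ((v \<bullet> x) * (v \<bullet> x)) \<ge> 0" for x using e by simp
  show "positive_semidefinite (A + e *\<^sub>R outer v)"
    unfolding positive_semidefinite_def quad
    using subspace_add[OF sym_mats_subspace sym subspace_scale[OF sym_mats_subspace sym_outer]]
      psd nn by (simp add: add_nonneg_nonneg)
  show "(A + e *\<^sub>R outer v) *v x = 0 \<longleftrightarrow> A *v x = 0 \<and> v \<bullet> x = 0"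
  proof
    assume "(A + e *\<^sub>R outer v) *v x = 0"
    then have "x \<bullet> (A *v x) + e * ((v \<bullet> x) * (v \<bullet> x)) = 0" by (simp add: quad[symmetric])
    with psd[of x] nn[of x] have "x \<bullet> (A *v x) = 0" "e * ((v \<bullet> x) * (v \<bullet> x)) = 0" by linarith+
    then show "A *v x = 0 \<and> v \<bullet> x = 0" using psd_isotropic_in_kernel[OF A] e by simp
  qed (simp add: val)
qed

text \<open>
  The new kernel is the orthogonal complement of \<open>v\<close> in the old one.
\<close>

lemma rank_plus_outer:
  assumes A: "positive_semidefinite A" and e: "e > 0" and v: "v \<noteq> 0" "A *v v = 0"
  shows "rank (A + e *\<^sub>R outer v) = rank A + 1"
proof -
  let ?N = "{x. A *v x = 0}"
  have "{y \<in> ?N. \<forall>x\<in>span {v}. orthogonal x y} = {x. (A + e *\<^sub>R outer v) *v x = 0}"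
    using span_base[of v "{v}"]
    by (auto simp: psd_plus_outer(2)[OF A e] span_singleton orthogonal_def)
  moreover have "span {v} \<subseteq> ?N" using v(2) kernel_subspace[of A] by (intro span_minimal) auto
  from dim_subspace_orthogonal_to_vectors[OF subspace_span kernel_subspace this]
  have "dim {y \<in> ?N. \<forall>x\<in>span {v}. orthogonal x y} + dim (span {v}) = dim ?N" .
  moreover have "dim (span {v}) = 1"
    using v(1) dim_eq_card_independent[of "{v}"] by simp
  ultimately show ?thesis
    using rank_plus_nullity[of A] rank_plus_nullity[of "A + e *\<^sub>R outer v"] by simp
qed

lemma congruence_psd:
  assumes "positive_semidefinite A"
  shows "positive_semidefinite (G ** A ** Finite_Cartesian_Product.transpose G)"
proof -
  let ?T = "Finite_Cartesian_Product.transpose G"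
  have A: "Finite_Cartesian_Product.transpose A = A" and psd: "\<And>x. x \<bullet> (A *v x) \<ge> 0"
    using assms by (auto simp: positive_semidefinite_def sym_mats_def)
  have "x \<bullet> ((G ** A ** ?T) *v x) = (?T *v x) \<bullet> (A *v (?T *v x))" for x
    by (simp add: matrix_vector_mul_assoc[symmetric] dot_lmul_matrix[symmetric])
  then show ?thesis using psd A
    by (simp add: positive_semidefinite_def sym_mats_def matrix_transpose_mul matrix_mul_assoc)
qed

lemma congruence_rank:
  fixes A G :: "real ^ 'n ^ 'n"
  assumes "invertible G"
  shows "rank (G ** A ** Finite_Cartesian_Product.transpose G) = rank A"
proof (rule antisym)
  let ?T = "Finite_Cartesian_Product.transpose G"
  show "rank (G ** A ** ?T) \<le> rank A"
    using rank_mul_le_left[of "G ** A" ?T] rank_mul_le_right[of G A] by linarith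
  obtain H where H: "H ** G = mat 1" "G ** H = mat 1" using assms by (auto simp: invertible_def)
  have T: "?T ** Finite_Cartesian_Product.transpose H = mat 1"
    by (simp add: matrix_transpose_mul[symmetric] H)
  have "H ** (G ** A ** ?T) ** Finite_Cartesian_Product.transpose H
      = (H ** G) ** A ** (?T ** Finite_Cartesian_Product.transpose H)"
    by (simp only: matrix_mul_assoc)
  also have "\<dots> = A" by (simp add: H T)
  finally have eq: "A = H ** (G ** A ** ?T) ** Finite_Cartesian_Product.transpose H" by simp
  have "rank A \<le> rank (H ** (G ** A ** ?T))"
    by (subst eq) (rule rank_mul_le_left)
  also have "\<dots> \<le> rank (G ** A ** ?T)" by (rule rank_mul_le_right)
  finally show "rank A \<le> rank (G ** A ** ?T)" .
qed

lemma inner_transpose: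
  fixes A B :: "real ^ 'n ^ 'n"
  shows "Finite_Cartesian_Product.transpose A \<bullet> Finite_Cartesian_Product.transpose B = A \<bullet> B"
  unfolding inner_vec_def transpose_def by (simp, rule sum.swap)

lemma inner_matrix_mult_left:
  fixes X A C :: "real ^ 'n ^ 'n"
  shows "(X ** A) \<bullet> C = X \<bullet> (C ** Finite_Cartesian_Product.transpose A)"
proof -
  have "(X ** A) \<bullet> C = (\<Sum>i\<in>UNIV. \<Sum>j\<in>UNIV. \<Sum>k\<in>UNIV. X $ i $ k * A $ k $ j * C $ i $ j)"
    by (simp add: inner_vec_def matrix_matrix_mult_def sum_distrib_right)
  also have "\<dots> = (\<Sum>i\<in>UNIV. \<Sum>k\<in>UNIV. \<Sum>j\<in>UNIV. X $ i $ k * A $ k $ j * C $ i $ j)"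
    by (intro sum.cong refl sum.swap)
  also have "\<dots> = X \<bullet> (C ** Finite_Cartesian_Product.transpose A)"
    by (simp add: inner_vec_def matrix_matrix_mult_def transpose_def sum_distrib_left mult.commute mult.left_commute)
  finally show ?thesis .
qed

lemma matrix_mult_add_left: "(A + B) ** C = A ** C + B ** C"
  for A B C :: "real ^ 'n ^ 'n"
  by (simp add: matrix_matrix_mult_def vec_eq_iff sum.distrib algebra_simps)

lemma matrix_mult_scaleR_left: "(r *\<^sub>R A) ** B = r *\<^sub>R (A ** B)"
  and matrix_mult_scaleR_right: "A ** (r *\<^sub>R B) = r *\<^sub>R (A ** B)"
  for A B :: "real ^ 'n ^ 'n"
  by (simp_all add: matrix_matrix_mult_def vec_eq_iff sum_distrib_left algebra_simps)

lemma bounded_bilinear_matrix_mult: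
  "bounded_bilinear ((**) :: real ^ 'n ^ 'n \<Rightarrow> real ^ 'n ^ 'n \<Rightarrow> real ^ 'n ^ 'n)"
  unfolding bilinear_conv_bounded_bilinear[symmetric] bilinear_def
  by (auto intro!: linearI simp: matrix_add_ldistrib matrix_mult_add_left
      matrix_mult_scaleR_left matrix_mult_scaleR_right)

lemma linear_transpose:
  "linear (Finite_Cartesian_Product.transpose :: real ^ 'n ^ 'n \<Rightarrow> real ^ 'n ^ 'n)"
  by (rule linearI) (simp_all add: transpose_def vec_eq_iff)

text \<open>
  The matrices \<open>X A + A X\<^sup>T\<close> form the tangent space at \<open>A\<close> of its orbit under congruence. A matrix
  orthogonal to this space and to \<open>L\<close> violates nondegeneracy once it is known to be symmetric;
  adding the skew-symmetric matrices to \<open>L\<close> enforces that and lets the target be the full matrix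
  space.
\<close>

lemma nondegenerate_transversal:
  fixes A :: "real ^ 'n ^ 'n" and M :: "(real ^ 'n ^ 'n) set"
  assumes L: "subspace L" "L \<subseteq> sym_mats" "\<not> rank_degenerate L" and A: "A \<in> L" "A \<noteq> 0"
  defines "M \<equiv> {l + k | l k. l \<in> L \<and> Finite_Cartesian_Product.transpose k = - k}"
  shows "subspace M"
    and "\<exists>X m. m \<in> M \<and> X ** A + A ** Finite_Cartesian_Product.transpose X - m = Q"
proof -
  have "subspace {k :: real ^ 'n ^ 'n. Finite_Cartesian_Product.transpose k = - k}"
    by (auto simp: subspace_def linear_0[OF linear_transpose] linear_add[OF linear_transpose]
        linear_scale[OF linear_transpose])
  from subspace_sums[OF L(1) this] show M: "subspace M"
  proof (rule back_subst[of subspace])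
    show "{x + y |x y. x \<in> L \<and> y \<in> {k. Finite_Cartesian_Product.transpose k = - k}} = M"
      unfolding M_def by simp
  qed
  have symA: "Finite_Cartesian_Product.transpose A = A" using A L by (auto simp: sym_mats_def)
  define N where "N = {X ** A + A ** Finite_Cartesian_Product.transpose X - m | X m. m \<in> M}"
  have N: "subspace N"
  proof (rule subspaceI)
    show "0 \<in> N" unfolding N_def using subspace_0[OF M]
      by (intro CollectI exI[of _ 0]) (simp add: linear_0[OF linear_transpose])
  next
    fix x y assume "x \<in> N" "y \<in> N"
    then obtain X m Y m' where eq: "m \<in> M" "x = X ** A + A ** Finite_Cartesian_Product.transpose X - m"
      "m' \<in> M" "y = Y ** A + A ** Finite_Cartesian_Product.transpose Y - m'" unfolding N_def by blast
    have "x + y = (X + Y) ** A + A ** Finite_Cartesian_Product.transpose (X + Y) - (m + m')"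
      by (simp add: eq linear_add[OF linear_transpose] matrix_add_ldistrib matrix_mult_add_left)
    then show "x + y \<in> N" using subspace_add[OF M eq(1,3)] unfolding N_def by blast
  next
    fix r x assume "x \<in> N"
    then obtain X m where eq: "m \<in> M" "x = X ** A + A ** Finite_Cartesian_Product.transpose X - m"
      unfolding N_def by blast
    have "r *\<^sub>R x = (r *\<^sub>R X) ** A + A ** Finite_Cartesian_Product.transpose (r *\<^sub>R X) - r *\<^sub>R m"
      by (simp add: eq linear_scale[OF linear_transpose] matrix_mult_scaleR_left
          matrix_mult_scaleR_right scaleR_add_right scaleR_diff_right)
    then show "r *\<^sub>R x \<in> N" using subspace_scale[OF M eq(1)] unfolding N_def by blast
  qed
  have "N = UNIV"
  proof (rule ccontr)
    assume "N \<noteq> UNIV"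
    moreover have "span N = N" using N by (simp add: span_eq_iff)
    ultimately have "span N \<subset> span UNIV" by (metis psubsetI span_UNIV subset_UNIV)
    from orthogonal_to_subspace_exists_gen[OF this] obtain C where
      C: "C \<noteq> 0" "\<And>y. y \<in> span N \<Longrightarrow> orthogonal C y" by auto
    have CN: "y \<bullet> C = 0" if "y \<in> N" for y
      using C(2)[of y] that by (simp add: span_base orthogonal_def inner_commute)
    have CM: "m \<bullet> C = 0" if "m \<in> M" for m
    proof -
      have "0 ** A + A ** Finite_Cartesian_Product.transpose 0 - m \<in> N" unfolding N_def using that by blast
      then have "- m \<in> N" by (simp add: linear_0[OF linear_transpose])
      from CN[OF this] show ?thesis by simp
    qed
    have CX: "(X ** A + A ** Finite_Cartesian_Product.transpose X) \<bullet> C = 0" for X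
    proof -
      have "X ** A + A ** Finite_Cartesian_Product.transpose X - 0 \<in> N"
        unfolding N_def using subspace_0[OF M] by blast
      from CN[OF this] show ?thesis by simp
    qed
    let ?T = "Finite_Cartesian_Product.transpose C"
    have symC: "?T = C"
    proof -
      have sk: "Finite_Cartesian_Product.transpose (C - ?T) = - (C - ?T)"
        by (simp add: linear_diff[OF linear_transpose])
      have "0 + (C - ?T) \<in> M" unfolding M_def using sk subspace_0[OF L(1)] by blast
      then have z: "(C - ?T) \<bullet> C = 0" using CM[of "0 + (C - ?T)"] by simp
      have "(C - ?T) \<bullet> ?T = Finite_Cartesian_Product.transpose (C - ?T) \<bullet> C"
        using inner_transpose[of "C - ?T" ?T] by simp
      also have "\<dots> = 0" unfolding sk inner_minus_left using z by simp
      finally have "(C - ?T) \<bullet> (C - ?T) = 0" using z by (simp add: inner_diff_right)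
      then show ?thesis by simp
    qed
    have "(C ** A) \<bullet> (C ** A) = 0"
    proof -
      let ?X = "C ** A"
      have "(A ** Finite_Cartesian_Product.transpose ?X) \<bullet> C = (?X ** A) \<bullet> C"
        using inner_transpose[of "?X ** A" C] by (simp add: matrix_transpose_mul symA symC)
      then have "(?X ** A) \<bullet> C = 0" using CX[of ?X] by (simp add: inner_add_left)
      then show ?thesis by (simp add: inner_matrix_mult_left symA)
    qed
    then have "C ** A = 0" by simp
    then have "Finite_Cartesian_Product.transpose (C ** A) = 0" by (simp add: linear_0[OF linear_transpose])
    then have "A ** C = 0" by (simp add: matrix_transpose_mul symA symC)
    moreover have "B \<bullet> C = 0" if "B \<in> L" for B
    proof -
      have "B + 0 \<in> M" unfolding M_def using that
        by (intro CollectI exI[of _ B] exI[of _ 0]) (simp add: linear_0[OF linear_transpose])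
      then show ?thesis using CM[of "B + 0"] by simp
    qed
    ultimately have "rank_degenerate L"
      unfolding rank_degenerate_def using A C(1) symC by (auto simp: sym_mats_def)
    with L(3) show False by blast
  qed
  then have "Q \<in> N" by simp
  then show "\<exists>X m. m \<in> M \<and> X ** A + A ** Finite_Cartesian_Product.transpose X - m = Q"
    unfolding N_def by blast
qed

lemma open_invertible_translates: "open {X :: real ^ 'n ^ 'n. invertible (mat 1 + X)}"
proof -
  have "continuous_on UNIV (\<lambda>X :: real ^ 'n ^ 'n. Determinants.det (mat 1 + X))"
    unfolding Determinants.det_def by (intro continuous_intros)
  then have "open ((\<lambda>X :: real ^ 'n ^ 'n. Determinants.det (mat 1 + X)) -` (- {0}))"
    by (intro open_vimage open_Compl closed_singleton)
  then show ?thesis by (simp add: vimage_def invertible_det_nz)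
qed

text \<open>
  Let \<open>v\<close> be a nonzero kernel vector of \<open>A\<close>. The matrix \<open>A + \<epsilon> v v\<^sup>T\<close> is PSD of the right rank but
  need not lie in \<open>L\<close>. By transversality, the map that sends \<open>(X, Y, \<epsilon>)\<close> to \<open>((1 + X) (A + \<epsilon> v
  v\<^sup>T) (1 + X)\<^sup>T - A - p Y, \<epsilon>)\<close>, with \<open>p\<close> a projection onto \<open>L\<close> plus the skew-symmetric matrices,
  has a surjective derivative at the origin. So the value \<open>(0, \<epsilon>)\<close> is attained near the origin for
  small \<open>\<epsilon> > 0\<close>, and a congruence moves the matrix into \<open>L\<close>.
\<close>

lemma nondegenerate_rank_increase:
  fixes A :: "real ^ 'n ^ 'n"
  assumes L: "subspace L" "L \<subseteq> sym_mats" "\<not> rank_degenerate L"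
    and A: "A \<in> L" "positive_semidefinite A" "A \<noteq> 0" and rk: "rank A < CARD('n)"
  shows "\<exists>A'\<in>L. positive_semidefinite A' \<and> rank A' = rank A + 1"
proof -
  let ?tr = "Finite_Cartesian_Product.transpose :: real ^ 'n ^ 'n \<Rightarrow> _"
  obtain v where v: "v \<noteq> 0" "A *v v = 0"
    using matrix_nonfull_linear_equations_eq[of A] rk by auto
  \<comment> \<open>the symmetric matrices in \<open>M\<close> are those in \<open>L\<close>\<close>
  define M where "M = {l + k | l k. l \<in> L \<and> ?tr k = - k}"
  have M: "subspace M" and sur: "\<And>Q. \<exists>X m. m \<in> M \<and> X ** A + A ** ?tr X - m = Q"
    unfolding M_def using nondegenerate_transversal[OF L A(1,3)] by blast+
  have "inj_on (\<lambda>x. x) M" by simp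
  from linear_exists_left_inverse_on[OF linear_ident M this]
  obtain p where p: "linear p" "range p \<subseteq> M" "\<And>x. x \<in> M \<Longrightarrow> p x = x" by blast
  define V where "V = outer v"
  define H where "H = (\<lambda>(X, Y, e :: real). ((mat 1 + X) ** (A + e *\<^sub>R V) ** ?tr (mat 1 + X) - A - p Y, e))"
  define H' where "H' = (\<lambda>(X, Y, e :: real). (X ** A + A ** ?tr X + e *\<^sub>R V - p Y, e))"
  note bb = bounded_bilinear_matrix_mult[where 'n='n]
  have bltr: "bounded_linear ?tr" and blp: "bounded_linear p"
    using linear_transpose p(1) by (simp_all add: linear_conv_bounded_linear)
  note bounded_linear.has_derivative[OF bltr, derivative_intros]
    bounded_linear.has_derivative[OF blp, derivative_intros]
    bounded_bilinear.FDERIV[OF bb, derivative_intros]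
  have trI: "?tr (mat 1) = mat 1" by simp
  have der: "(H has_derivative H') (at 0)"
    unfolding H_def H'_def split_beta
    by (rule has_derivative_eq_rhs, (rule derivative_intros)+)
       (auto simp: fun_eq_iff trI linear_0[OF linear_transpose] algebra_simps)
  have "surj H'"
  proof (rule surjI)
    fix z show "H' (SOME y. H' y = z) = z"
    proof (rule someI_ex)
      obtain Q s where z: "z = (Q, s)" by (cases z)
      obtain X m where "m \<in> M" "X ** A + A ** ?tr X - m = Q - s *\<^sub>R V" using sur by blast
      then have "H' (X, m, s) = z" by (simp add: H'_def z p(3) algebra_simps)
      then show "\<exists>y. H' y = z" by blast
    qed
  qed
  moreover have linH: "linear H'" using der has_derivative_linear by blast
  ultimately obtain g where g: "linear g" "H' \<circ> g = id"
    using linear_surjective_right_inverse by blast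
  have cont: "continuous_on UNIV H"
    unfolding H_def split_beta
    by (intro continuous_intros bounded_bilinear.continuous_on[OF bb]
        bounded_linear.continuous_on[OF bltr] bounded_linear.continuous_on[OF blp])
  define T where "T = {X :: real ^ 'n ^ 'n. invertible (mat 1 + X)} \<times> (UNIV :: ((real ^ 'n ^ 'n) \<times> real) set)"
  have "open T" unfolding T_def by (intro open_Times open_invertible_translates open_UNIV)
  moreover have "0 \<in> T" by (simp add: T_def zero_prod_def invertible_def)
  ultimately have "0 \<in> interior T" by (simp add: interior_open)
  from sussmann_open_mapping[OF open_UNIV cont UNIV_I der _ g(2) subset_UNIV this] g(1)
  have "H 0 \<in> interior (H ` T)" by (simp add: linear_conv_bounded_linear)
  moreover have "H 0 = 0" by (simp add: H_def zero_prod_def linear_0[OF p(1)])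
  ultimately obtain r where r: "r > 0" "ball 0 r \<subseteq> H ` T" unfolding mem_interior by auto
  have "(0, r / 2) \<in> ball (0 :: (real ^ 'n ^ 'n) \<times> real) r"
    using r(1) by (simp add: dist_norm norm_Pair)
  with r(2) have "(0, r / 2) \<in> H ` T" by blast
  then obtain X Y where XY: "invertible (mat 1 + X)" "H (X, Y, r / 2) = (0, r / 2)"
    by (auto simp: T_def H_def)
  define A1 where "A1 = A + (r / 2) *\<^sub>R V"
  define A' where "A' = (mat 1 + X) ** A1 ** ?tr (mat 1 + X)"
  have r2: "r / 2 > 0" using r(1) by simp
  have psd: "positive_semidefinite A'" unfolding A'_def A1_def V_def
    by (intro congruence_psd psd_plus_outer(1) A(2) r2)
  have rank: "rank A' = rank A + 1" unfolding A'_def A1_def V_def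
    by (simp only: congruence_rank[OF XY(1)] rank_plus_outer[OF A(2) r2 v])
  have "A' - A = p Y" using XY(2) by (simp add: H_def A'_def A1_def)
  moreover have "p Y \<in> M" using p(2) by blast
  ultimately obtain l k where lk: "A' - A = l + k" "l \<in> L" "?tr k = - k" unfolding M_def by auto
  have "A' \<in> sym_mats" using psd by (simp add: positive_semidefinite_def)
  moreover have "k = A' - A - l" using lk(1) by simp
  ultimately have "k \<in> sym_mats"
    using L(2) A(1) lk(2) subspace_diff[OF sym_mats_subspace] by (metis subsetD)
  then have "k = - k" using lk(3) by (simp add: sym_mats_def)
  then have "(2 :: real) *\<^sub>R k = 0" by (metis add.right_inverse scaleR_2)
  then have "k = 0" by simp
  then have "A' = A + l" using lk(1) by (simp add: algebra_simps)
  then have "A' \<in> L" using subspace_add[OF L(1) A(1) lk(2)] by simp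
  with psd rank show ?thesis by blast
qed

section \<open>Semidefinite matrices of prescribed rank\<close>

lemma choose_two_double: "2 * (n choose 2) = n * (n - 1)"
  unfolding choose_two by (cases n) auto

text \<open>
  The lower bound on \<open>m\<close> equals \<open>(n + 1 choose 2) - (n - d + 2 choose 2) + 2\<close>, and \<open>w + 1 \<ge> n - d
  + 2\<close> if a matrix of rank \<open>w\<close> has a kernel of dimension less than \<open>d\<close>.
\<close>

lemma conditions_below_dimension:
  fixes n d w c m :: nat
  assumes "d \<le> n" "n + 1 \<le> w + d" and c: "c + ((w + 1) choose 2) = (n + 1) choose 2"
    and m: "int m \<ge> int d * int n - int (d choose 2) - int n + int d + 1"
  shows "c + 1 < m"
proof -
  obtain k where n: "n = k + d" using assms(1) by (metis add.commute le_iff_add)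
  have "2 * c + (w + 1) * w = (n + 1) * n"
    using c choose_two_double[of "w + 1"] choose_two_double[of "n + 1"] by simp
  moreover have "(k + 2) * (k + 1) \<le> (w + 1) * w"
    using assms(2) n by (intro mult_le_mono) auto
  ultimately have "2 * c + (k + 2) * (k + 1) \<le> (k + d + 1) * (k + d)" by (simp add: n)
  then have "int (2 * c + (k + 2) * (k + 1)) \<le> int ((k + d + 1) * (k + d))"
    by (simp only: of_nat_le_iff)
  then have 1: "2 * int c + (int k + 2) * (int k + 1) \<le> (int k + int d + 1) * (int k + int d)"
    by (simp add: algebra_simps)
  have "int (2 * (d choose 2)) = int d * (int d - 1)"
    unfolding choose_two_double by (cases d) (auto simp: algebra_simps)
  then have "2 * int m \<ge> 2 * int d * (int k + int d) - int d * (int d - 1) - 2 * (int k + int d) + 2 * int d + 2"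
    using m by (simp add: n algebra_simps)
  then have "2 * int c + 4 \<le> 2 * int m" using 1 by (simp add: algebra_simps)
  then show ?thesis by simp
qed

lemma nondegenerate_contains_psd_of_rank:
  fixes L :: "(real ^ 'n ^ 'n) set"
  assumes L: "L \<in> Gr_sym m" "\<not> rank_degenerate L" and PD: "A\<^sub>0 \<in> L" "positive_definite A\<^sub>0"
    and d: "d \<le> CARD('n) - 1"
    and m: "int m \<ge> int d * int CARD('n) - int (d choose 2) - int CARD('n) + int d + 1"
  shows "\<exists>A\<in>L. positive_semidefinite A \<and> rank A = CARD('n) - d"
proof -
  let ?n = "CARD('n)"
  have sub: "subspace L" "L \<subseteq> sym_mats" "dim L = m" using L by (auto simp: Gr_sym_def)
  have n: "?n \<ge> 1" by (simp add: Suc_le_eq)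
  have A0: "positive_semidefinite A\<^sub>0" unfolding positive_semidefinite_def
  proof (intro conjI allI)
    fix x show "0 \<le> x \<bullet> (A\<^sub>0 *v x)"
      using PD(2) by (cases "x = 0") (auto simp: positive_definite_def less_imp_le)
  qed (use PD(2) in \<open>simp add: positive_definite_def\<close>)
  have "A\<^sub>0 \<noteq> 0"
  proof
    assume "A\<^sub>0 = 0"
    moreover have "axis undefined 1 \<noteq> (0 :: real ^ 'n)" by (simp add: axis_eq_0_iff)
    ultimately show False using PD(2) unfolding positive_definite_def by force
  qed
  \<comment> \<open>descend along faces of the PSD cone; the dimension bound is good for \<open>d\<close> steps\<close>
  have "\<exists>A\<in>L. positive_semidefinite A \<and> A \<noteq> 0 \<and> rank A \<le> ?n - e" if "e \<le> d" for e
    using that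
  proof (induction e)
    case 0
    have "rank A\<^sub>0 \<le> ?n" using rank_bound[of A\<^sub>0] by simp
    then show ?case using PD A0 \<open>A\<^sub>0 \<noteq> 0\<close> by auto
  next
    case (Suc e)
    then obtain A where A: "A \<in> L" "positive_semidefinite A" "A \<noteq> 0" "rank A \<le> ?n - e" by auto
    show ?case
    proof (cases "rank A \<le> ?n - Suc e")
      case False
      then have rk: "rank A \<ge> ?n - d + 1" using Suc.prems d n by linarith
      obtain W U where W: "column_basis A W U" using column_basis_exists by blast
      have cW: "card W = rank A" by (rule card_column_basis[OF W])
      have "card (upper - W \<times> W) + 1 < dim L"
      proof -
        have "card (upper - W \<times> W) + card (upper \<inter> W \<times> W)
            = card ((upper - W \<times> W) \<union> (upper \<inter> W \<times> W))"
          by (rule card_Un_disjoint[symmetric]) auto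
        also have "(upper - W \<times> W) \<union> (upper \<inter> W \<times> W) = upper" by blast
        finally have "card (upper - W \<times> W) + ((card W + 1) choose 2) = (?n + 1) choose 2"
          unfolding card_upper card_upper_square .
        moreover have "?n + 1 \<le> card W + d" using rk cW by linarith
        ultimately show ?thesis
          unfolding sub(3) using d m by (intro conditions_below_dimension[of d ?n "card W"]) auto
      qed
      from linear_conditions_on_kernel[OF W sub(1,2) A(3) this]
      obtain B where B: "B \<in> L" "\<And>x. A *v x = 0 \<Longrightarrow> B *v x = 0" "\<And>t. B \<noteq> t *\<^sub>R A" by blast
      from psd_boundary_in_pencil[OF A(2,3) _ B(2)] B(1) sub(2)
      obtain t where t: "positive_semidefinite (B - t *\<^sub>R A)" "rank (B - t *\<^sub>R A) < rank A" by blast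
      have "B - t *\<^sub>R A \<in> L" using subspace_diff[OF sub(1) B(1) subspace_scale[OF sub(1) A(1)]] .
      moreover have "B - t *\<^sub>R A \<noteq> 0" using B(3)[of t] by simp
      moreover have "rank (B - t *\<^sub>R A) \<le> ?n - Suc e" using t(2) A(4) by linarith
      ultimately show ?thesis using t(1) by blast
    qed (use A in blast)
  qed
  then obtain A where A: "A \<in> L" "positive_semidefinite A" "A \<noteq> 0" "rank A \<le> ?n - d" by blast
  \<comment> \<open>a step down may skip ranks, so climb back one rank at a time\<close>
  have "\<exists>A'\<in>L. positive_semidefinite A' \<and> A' \<noteq> 0 \<and> rank A' = rank A + j" if "rank A + j \<le> ?n - d" for j
    using that
  proof (induction j)
    case 0
    then show ?case using A by auto
  next
    case (Suc j)
    then obtain A' where A': "A' \<in> L" "positive_semidefinite A'" "A' \<noteq> 0" "rank A' = rank A + j" by auto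
    have "rank A' < ?n" using Suc.prems A'(4) by linarith
    from nondegenerate_rank_increase[OF sub(1,2) L(2) A'(1-3) this]
    obtain A'' where A'': "A'' \<in> L" "positive_semidefinite A''" "rank A'' = rank A' + 1" by blast
    have "A'' \<noteq> 0"
    proof
      assume "A'' = 0"
      then show False using A''(3) by simp
    qed
    then show ?case using A'' A'(4) by auto
  qed
  moreover have "rank A + (?n - d - rank A) = ?n - d" using A(4) by simp
  ultimately show ?thesis by (metis order_refl)
qed

section \<open>Parametrizing annihilating pairs of symmetric matrices\<close>

lemma sep_poly_times:
  assumes "sep_poly K D f" "sep_poly K D' g" "D + D' \<le> D''"
  shows "sep_poly K D'' (\<lambda>x. f x * g x)"
  using sep_poly_mono[OF sep_poly_mult[OF assms(1,2)] assms(3)] .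

lemma sep_poly_if:
  "(P \<Longrightarrow> sep_poly K D f) \<Longrightarrow> (\<not> P \<Longrightarrow> sep_poly K D g) \<Longrightarrow>
    sep_poly K D (\<lambda>x. if P then f x else g x)"
  by (cases P) simp_all

text \<open>
  The congruence \<open>Z\<^sup>T Y Z\<close> of the block \<open>Y\<close> of \<open>y\<close> on \<open>W\<close>, where \<open>Z\<close> has the rows \<open>W\<close> and consists
  of the identity in the columns \<open>W\<close> and of \<open>s\<close> times the entries of \<open>y\<close> in the other columns.
  With \<open>s = 1\<close> for \<open>W\<close> and \<open>s = - 1\<close> for its complement, the same symmetric \<open>y\<close> describes a matrix
  and another one that annihilates it.
\<close>

definition pair_form :: "'n::finite set \<Rightarrow> real \<Rightarrow> ('n \<Rightarrow> 'n \<Rightarrow> real) \<Rightarrow> 'n \<Rightarrow> 'n \<Rightarrow> real" where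
  "pair_form W s y i j =
     (\<Sum>k\<in>W. \<Sum>l\<in>W. (if i \<in> W then (if k = i then 1 else 0) else s * y k i) * y k l *
        (if j \<in> W then (if l = j then 1 else 0) else s * y l j))"

lemma pair_form_cong:
  assumes "\<And>k i. k \<in> W \<Longrightarrow> Z k i = (if i \<in> W then (if k = i then 1 else 0) else s * y k i)"
  shows "pair_form W s y i j = (\<Sum>k\<in>W. \<Sum>l\<in>W. Z k i * y k l * Z l j)"
  unfolding pair_form_def by (intro sum.cong refl) (simp add: assms)

lemma sep_poly_pair_form:
  assumes y: "\<And>k l. sep_poly K 1 (\<lambda>x. y x k l)"
  shows "sep_poly K 3 (\<lambda>x. pair_form W s (y x) i j)"
proof -
  have Z: "sep_poly K 1 (\<lambda>x. if i \<in> W then (if k = i then 1 else 0) else s * y x k i)" for k i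
    by (intro sep_poly_if sep_poly_const sep_poly_times[OF sep_poly_const[of K 0 s] y[of k i]]) simp
  show ?thesis unfolding pair_form_def
    by (intro sep_poly_sum sep_poly_times[OF sep_poly_times[OF Z y order_refl] Z]) simp
qed

text \<open>
  If \<open>W\<close> indexes a basis of the columns of \<open>A\<close> with coordinates \<open>U\<close>, then symmetry of \<open>A\<close> turns \<open>A
  = A\<^sub>W U\<close> into a congruence of its block on \<open>W\<close>, and the kernel of \<open>A\<close>, which contains the
  columns of \<open>C\<close>, is the graph of \<open>- U\<close>. The matrix \<open>y\<close> is assembled from the block of \<open>A\<close>, the
  block of \<open>C\<close> and \<open>U\<close>; the two blocks are scaled so that an entry becomes \<open>1\<close>, which saves two
  parameters.
\<close>

lemma annihilating_pair_parametrized: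
  fixes A C :: "real ^ 'n ^ 'n"
  assumes A: "A \<in> sym_mats" "A \<noteq> 0" and C: "C \<in> sym_mats" "C \<noteq> 0" and AC: "A ** C = 0"
  obtains p W q a c y where "p \<in> upper \<inter> W \<times> W" "q \<in> upper \<inter> (- W) \<times> (- W)" "a \<noteq> 0" "c \<noteq> 0"
    "\<And>i j. y i j = y j i" "y (fst p) (snd p) = 1" "y (fst q) (snd q) = 1"
    "\<And>i j. A $ i $ j = a * pair_form W 1 y i j"
    "\<And>i j. C $ i $ j = c * pair_form (- W) (-1) y i j"
proof -
  obtain W U where W: "column_basis A W U" using column_basis_exists by blast
  have Asym: "A $ i $ j = A $ j $ i" and Csym: "C $ i $ j = C $ j $ i" for i j
    using A(1) C(1) sym_matsD by blast+
  have Aform: "A $ i $ j = (\<Sum>k\<in>W. \<Sum>l\<in>W. U k i * A $ k $ l * U l j)" for i j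
  proof -
    have "A $ i $ j = (\<Sum>l\<in>W. A $ i $ l * U l j)" by (rule column_basisD(2)[OF W])
    also have "\<dots> = (\<Sum>l\<in>W. (\<Sum>k\<in>W. A $ l $ k * U k i) * U l j)"
      by (intro sum.cong refl arg_cong2[of _ _ _ _ "(*)"] trans[OF Asym column_basisD(2)[OF W]])
    also have "\<dots> = (\<Sum>l\<in>W. \<Sum>k\<in>W. U k i * A $ k $ l * U l j)"
      unfolding sum_distrib_right
    proof (intro sum.cong refl)
      fix l k show "A $ l $ k * U k i * U l j = U k i * A $ k $ l * U l j"
        using Asym[of l k] by simp
    qed
    also have "\<dots> = (\<Sum>k\<in>W. \<Sum>l\<in>W. U k i * A $ k $ l * U l j)" by (rule sum.swap)
    finally show ?thesis .
  qed
  define Z where "Z = (\<lambda>i k. if k \<in> W then - U k i else if i = k then 1 else 0)"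
  have Crow: "C $ k $ j = (\<Sum>i\<in>-W. Z i k * C $ i $ j)" for k j
  proof (cases "k \<in> W")
    case True
    have "(A *v (\<chi> i. C $ i $ j)) $ i = (A ** C) $ i $ j" for i
      by (simp add: matrix_vector_mult_def matrix_matrix_mult_def)
    then have "A *v (\<chi> i. C $ i $ j) = 0" by (simp add: AC vec_eq_iff)
    then have "(\<Sum>i\<in>UNIV. U k i * C $ i $ j) = 0"
      unfolding column_basis_kernel[OF W] using True by simp
    then have "C $ k $ j = - (\<Sum>i\<in>-W. U k i * C $ i $ j)"
      using column_basis_row_sum[OF W True, of "\<lambda>i. C $ i $ j"] by simp
    then show ?thesis using True by (simp add: Z_def sum_negf)
  next
    case False
    then have "(\<Sum>i\<in>-W. Z i k * C $ i $ j) = (\<Sum>i\<in>-W. if i = k then C $ i $ j else 0)"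
      by (intro sum.cong) (auto simp: Z_def)
    then show ?thesis using False by simp
  qed
  have Cform: "C $ i $ j = (\<Sum>k\<in>-W. \<Sum>l\<in>-W. Z k i * C $ k $ l * Z l j)" for i j
  proof -
    have "C $ i $ j = (\<Sum>k\<in>-W. Z k i * C $ k $ j)" by (rule Crow)
    also have "\<dots> = (\<Sum>k\<in>-W. Z k i * (\<Sum>l\<in>-W. Z l j * C $ l $ k))"
      by (intro sum.cong refl arg_cong2[of _ _ _ _ "(*)"] trans[OF Csym Crow])
    also have "\<dots> = (\<Sum>k\<in>-W. \<Sum>l\<in>-W. Z k i * C $ k $ l * Z l j)"
      unfolding sum_distrib_left
    proof (intro sum.cong refl)
      fix l k show "Z k i * (Z l j * C $ l $ k) = Z k i * C $ k $ l * Z l j"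
        using Csym[of l k] by simp
    qed
    finally show ?thesis .
  qed
  have "\<exists>k\<in>W. \<exists>l\<in>W. A $ k $ l \<noteq> 0"
  proof (rule ccontr)
    assume "\<not> ?thesis"
    then have "A $ i $ j = 0" for i j unfolding Aform[of i j] by (intro sum.neutral ballI) auto
    then show False using A(2) by (simp add: vec_eq_iff)
  qed
  then obtain k l where kl: "k \<in> W" "l \<in> W" "A $ k $ l \<noteq> 0" by blast
  have "\<exists>k\<in>-W. \<exists>l\<in>-W. C $ k $ l \<noteq> 0"
  proof (rule ccontr)
    assume "\<not> ?thesis"
    then have "C $ i $ j = 0" for i j unfolding Cform[of i j] by (intro sum.neutral ballI) auto
    then show False using C(2) by (simp add: vec_eq_iff)
  qed
  then obtain k' l' where kl': "k' \<in> -W" "l' \<in> -W" "C $ k' $ l' \<noteq> 0" by blast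
  define p where "p = upper_rep k l"
  define q where "q = upper_rep k' l'"
  define a where "a = A $ fst p $ snd p"
  define c where "c = C $ fst q $ snd q"
  have p: "p \<in> upper" "fst p \<in> W" "snd p \<in> W" and q: "q \<in> upper" "fst q \<notin> W" "snd q \<notin> W"
    using kl(1,2) kl'(1,2) upper_rep_in_upper[of k l] upper_rep_in_upper[of k' l'] by (auto simp: p_def q_def upper_rep_def)
  have a: "a \<noteq> 0" and c: "c \<noteq> 0"
    using kl(3) kl'(3) sym_upper_rep[OF A(1), of k l] sym_upper_rep[OF C(1), of k' l'] by (auto simp: a_def c_def p_def q_def)
  define y where "y = (\<lambda>i j. if i \<in> W then if j \<in> W then A $ i $ j / a else U i j
      else if j \<in> W then U j i else C $ i $ j / c)"
  have ysym: "y i j = y j i" for i j using Asym[of i j] Csym[of i j] by (simp add: y_def)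
  have Ay: "A $ i $ j = a * pair_form W 1 y i j" for i j
  proof -
    have "pair_form W 1 y i j = (\<Sum>k\<in>W. \<Sum>l\<in>W. U k i * y k l * U l j)"
      by (rule pair_form_cong) (simp add: y_def column_basisD(3)[OF W])
    also have "\<dots> = (\<Sum>k\<in>W. \<Sum>l\<in>W. (U k i * A $ k $ l * U l j) / a)"
      by (intro sum.cong refl) (simp add: y_def)
    also have "\<dots> = A $ i $ j / a" unfolding Aform[of i j] sum_divide_distrib ..
    finally show ?thesis using a by simp
  qed
  have Cy: "C $ i $ j = c * pair_form (- W) (-1) y i j" for i j
  proof -
    have "pair_form (- W) (-1) y i j = (\<Sum>k\<in>-W. \<Sum>l\<in>-W. Z k i * y k l * Z l j)"
      by (rule pair_form_cong) (simp add: y_def Z_def)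
    also have "\<dots> = (\<Sum>k\<in>-W. \<Sum>l\<in>-W. (Z k i * C $ k $ l * Z l j) / c)"
      by (intro sum.cong refl) (simp add: y_def)
    also have "\<dots> = C $ i $ j / c" unfolding Cform[of i j] sum_divide_distrib ..
    finally show ?thesis using c by simp
  qed
  have y1: "y (fst p) (snd p) = 1" "y (fst q) (snd q) = 1"
    using p q a c by (simp_all add: y_def a_def c_def)
  have pq: "p \<in> upper \<inter> W \<times> W" "q \<in> upper \<inter> (- W) \<times> (- W)"
    using p q by (auto simp: mem_Times_iff)
  show ?thesis by (rule that[OF pq a c ysym y1 Ay Cy])
qed

text \<open>
  A space given as the graph of the matrix \<open>T\<close> contains the vector \<open>(a, b)\<close> and is orthogonal to
  the vector \<open>(u, w)\<close> if \<open>b\<close> is the image of \<open>a\<close> and \<open>- u\<close> is the image of \<open>w\<close> under the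
  transpose. If \<open>a i0\<close> and \<open>w j0\<close> are nonzero, these equations determine row \<open>i0\<close> and column \<open>j0\<close>
  of \<open>T\<close> from the remaining entries \<open>t\<close>. This is \<open>T\<close> multiplied by the common denominator \<open>a i0 *
  w j0\<close>.
\<close>

definition flag_num :: "nat \<Rightarrow> 'j set \<Rightarrow> nat \<Rightarrow> 'j \<Rightarrow> (nat \<Rightarrow> real) \<Rightarrow> ('j \<Rightarrow> real) \<Rightarrow> (nat \<Rightarrow> real) \<Rightarrow>
    ('j \<Rightarrow> real) \<Rightarrow> (nat \<Rightarrow> 'j \<Rightarrow> real) \<Rightarrow> nat \<Rightarrow> 'j \<Rightarrow> real" where
  "flag_num m J i0 j0 a b u w t i j =
     (if i \<noteq> i0 \<and> j \<noteq> j0 then t i j * (a i0 * w j0)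
      else if j \<noteq> j0 then w j0 * (b j - (\<Sum>i'\<in>{..<m} - {i0}. t i' j * a i'))
      else if i \<noteq> i0 then - (a i0 * (u i + (\<Sum>j'\<in>J - {j0}. w j' * t i j')))
      else - (u i0 * a i0 + (\<Sum>j'\<in>J - {j0}. w j' * (b j' - (\<Sum>i'\<in>{..<m} - {i0}. t i' j' * a i')))))"

lemma flag_num_eq:
  assumes fin: "finite J" and i0: "i0 < m" and j0: "j0 \<in> J"
    and b: "\<And>j. j \<in> J \<Longrightarrow> b j = (\<Sum>i<m. T i j * a i)"
    and u: "\<And>i. i < m \<Longrightarrow> u i = - (\<Sum>j\<in>J. w j * T i j)"
    and t: "\<And>i j. i < m \<Longrightarrow> j \<in> J \<Longrightarrow> i \<noteq> i0 \<Longrightarrow> j \<noteq> j0 \<Longrightarrow> t i j = T i j"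
    and ij: "i < m" "j \<in> J"
  shows "flag_num m J i0 j0 a b u w t i j = T i j * (a i0 * w j0)"
proof -
  have row: "b j' - (\<Sum>i'\<in>{..<m} - {i0}. t i' j' * a i') = T i0 j' * a i0"
    if "j' \<in> J" "j' \<noteq> j0" for j'
  proof -
    have "(\<Sum>i'\<in>{..<m} - {i0}. t i' j' * a i') = (\<Sum>i'\<in>{..<m} - {i0}. T i' j' * a i')"
      using that t by (intro sum.cong) auto
    moreover have "b j' = T i0 j' * a i0 + (\<Sum>i'\<in>{..<m} - {i0}. T i' j' * a i')"
      unfolding b[OF that(1)] using i0 by (subst sum.remove[of _ i0]) auto
    ultimately show ?thesis by simp
  qed
  have usplit: "u i' = - (w j0 * T i' j0 + (\<Sum>j'\<in>J - {j0}. w j' * T i' j'))" if "i' < m" for i'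
    unfolding u[OF that] using fin j0 by (subst sum.remove[of _ j0]) auto
  consider "i \<noteq> i0" "j \<noteq> j0" | "i = i0" "j \<noteq> j0" | "i \<noteq> i0" "j = j0" | "i = i0" "j = j0" by blast
  then show ?thesis
  proof cases
    case 1
    then show ?thesis using t[OF ij] by (simp add: flag_num_def)
  next
    case 2
    then show ?thesis using row[OF ij(2)] by (simp add: flag_num_def)
  next
    case 3
    have "(\<Sum>j'\<in>J - {j0}. w j' * t i j') = (\<Sum>j'\<in>J - {j0}. w j' * T i j')"
      using 3 ij t by (intro sum.cong) auto
    then show ?thesis using 3 usplit[OF ij(1)] by (simp add: flag_num_def algebra_simps)
  next
    case 4
    have "(\<Sum>j'\<in>J - {j0}. w j' * (b j' - (\<Sum>i'\<in>{..<m} - {i0}. t i' j' * a i')))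
        = (\<Sum>j'\<in>J - {j0}. w j' * T i0 j' * a i0)"
      by (intro sum.cong) (auto simp: row)
    also have "\<dots> = (\<Sum>j'\<in>J - {j0}. w j' * T i0 j') * a i0" by (simp add: sum_distrib_right)
    finally have "flag_num m J i0 j0 a b u w t i j
        = - (u i0 * a i0 + (\<Sum>j'\<in>J - {j0}. w j' * T i0 j') * a i0)"
      using 4 by (simp add: flag_num_def)
    also have "\<dots> = T i j * (a i0 * w j0)"
      unfolding usplit[OF i0] 4 by (simp add: algebra_simps)
    finally show ?thesis .
  qed
qed

text \<open>
  The degrees are those of the application: the vectors are cubic in the parameters and the free
  entries \<open>t\<close> are parameters themselves. The terms of highest degree are the products \<open>t * a * w\<close>.
\<close>

lemma sep_poly_flag_num:
  assumes a: "\<And>i. sep_poly K 3 (\<lambda>x. a x i)" and b: "\<And>j. sep_poly K 3 (\<lambda>x. b x j)"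
    and u: "\<And>i. sep_poly K 3 (\<lambda>x. u x i)" and w: "\<And>j. sep_poly K 3 (\<lambda>x. w x j)"
    and t: "\<And>i j. sep_poly K 1 (\<lambda>x. t x i j)"
  shows "sep_poly K 7 (\<lambda>x. flag_num m J i0 j0 (a x) (b x) (u x) (w x) (t x) i j)"
proof -
  have row: "sep_poly K 4 (\<lambda>x. b x j - (\<Sum>i'\<in>{..<m} - {i0}. t x i' j * a x i'))" for j
    by (intro sep_poly_diff sep_poly_sum sep_poly_times[OF t a] sep_poly_mono[OF b]) auto
  have 1: "sep_poly K 7 (\<lambda>x. t x i j * (a x i0 * w x j0))"
    by (rule sep_poly_times[OF t sep_poly_times[OF a w order_refl]]) simp
  have 2: "sep_poly K 7 (\<lambda>x. w x j0 * (b x j - (\<Sum>i'\<in>{..<m} - {i0}. t x i' j * a x i')))"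
    by (rule sep_poly_times[OF w row]) simp
  have "sep_poly K 4 (\<lambda>x. u x i + (\<Sum>j'\<in>J - {j0}. w x j' * t x i j'))"
    by (intro sep_poly_add sep_poly_sum sep_poly_times[OF w t] sep_poly_mono[OF u]) auto
  from sep_poly_uminus[OF sep_poly_times[OF a this]]
  have 3: "sep_poly K 7 (\<lambda>x. - (a x i0 * (u x i + (\<Sum>j'\<in>J - {j0}. w x j' * t x i j'))))" by simp
  have 4: "sep_poly K 7 (\<lambda>x. - (u x i0 * a x i0 +
      (\<Sum>j'\<in>J - {j0}. w x j' * (b x j' - (\<Sum>i'\<in>{..<m} - {i0}. t x i' j' * a x i')))))"
    by (intro sep_poly_uminus sep_poly_add sep_poly_sum sep_poly_times[OF w row] sep_poly_times[OF u a]) auto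
  show ?thesis unfolding flag_num_def by (intro sep_poly_if 1 2 3 4)
qed

section \<open>Affine charts of the Grassmannian\<close>

definition entry :: "real ^ 'n ^ 'n \<Rightarrow> 'n \<times> 'n \<Rightarrow> real" where
  "entry A p = A $ fst p $ snd p"

lemma entry_simps:
  "entry (A + B) p = entry A p + entry B p" "entry (c *\<^sub>R A) p = c * entry A p" "entry 0 p = 0"
  "entry (\<Sum>i\<in>I. f i) p = (\<Sum>i\<in>I. entry (f i) p)"
  by (simp_all add: entry_def)

lemma sum_indicator_mult:
  fixes f :: "nat \<Rightarrow> real"
  assumes "k < m"
  shows "(\<Sum>i<m. (if k = i then 1 else 0) * f i) = f k" "(\<Sum>i<m. f i * (if i = k then 1 else 0)) = f k"
proof -
  have "(\<Sum>i<m. (if k = i then 1 else 0) * f i) = (\<Sum>i<m. if k = i then f i else 0)"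
    by (intro sum.cong) auto
  then show "(\<Sum>i<m. (if k = i then 1 else 0) * f i) = f k" using assms by simp
  have "(\<Sum>i<m. f i * (if i = k then 1 else 0)) = (\<Sum>i<m. if i = k then f i else 0)"
    by (intro sum.cong) auto
  then show "(\<Sum>i<m. f i * (if i = k then 1 else 0)) = f k" using assms by simp
qed

text \<open>
  The number of positions of a symmetric matrix that hold the entry at \<open>p\<close>.
\<close>

definition orbit_size :: "'n \<times> 'n \<Rightarrow> real" where
  "orbit_size p = (if fst p = snd p then 1 else 2)"

lemma sym_inner_upper:
  fixes A C :: "real ^ 'n ^ 'n"
  assumes "A \<in> sym_mats" "C \<in> sym_mats"
  shows "A \<bullet> C = (\<Sum>p\<in>upper. entry A p * (orbit_size p * entry C p))"
proof -
  let ?F = "\<lambda>p. entry A p * entry C p"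
  let ?O = "{p \<in> upper. fst p \<noteq> snd p} :: ('n \<times> 'n) set"
  have swap: "?F (prod.swap p) = ?F p" for p
    using sym_matsD[OF assms(1), of "fst p" "snd p"] sym_matsD[OF assms(2), of "fst p" "snd p"]
    by (simp add: entry_def)
  have "A \<bullet> C = (\<Sum>p\<in>UNIV \<times> UNIV. ?F p)"
    by (simp add: inner_vec_def entry_def sum.cartesian_product split_beta)
  also have "UNIV \<times> UNIV = upper \<union> prod.swap ` ?O"
  proof (intro equalityI subsetI)
    fix p :: "'n \<times> 'n"
    obtain i j where p: "p = (i, j)" by (cases p)
    show "p \<in> upper \<union> prod.swap ` ?O"
    proof (cases "p \<in> upper")
      case False
      then have "(j, i) \<in> ?O" using upper_total[of i j] upper_refl[of i] by (auto simp: p)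
      moreover have "p = prod.swap (j, i)" by (simp add: p)
      ultimately show ?thesis by blast
    qed simp
  qed simp
  also have "(\<Sum>p\<in>\<dots>. ?F p) = (\<Sum>p\<in>upper. ?F p) + (\<Sum>p\<in>prod.swap ` ?O. ?F p)"
  proof (rule sum.union_disjoint)
    show "upper \<inter> prod.swap ` ?O = {}"
    proof (rule equals0I)
      fix p assume "p \<in> upper \<inter> prod.swap ` ?O"
      then obtain i j where "p = (j, i)" "(j, i) \<in> upper" "(i, j) \<in> upper" "i \<noteq> j" by auto
      then show False using upper_antisym by blast
    qed
  qed simp_all
  also have "(\<Sum>p\<in>prod.swap ` ?O. ?F p) = (\<Sum>p\<in>?O. ?F p)"
    using sum.reindex[OF inj_on_subset[OF inj_swap subset_UNIV], of ?F ?O] by (simp add: swap)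
  also have "\<dots> = (\<Sum>p\<in>upper. if fst p \<noteq> snd p then ?F p else 0)"
    by (rule sum.inter_filter) simp
  also have "(\<Sum>p\<in>upper. ?F p) + \<dots> = (\<Sum>p\<in>upper. entry A p * (orbit_size p * entry C p))"
    unfolding sum.distrib[symmetric] by (intro sum.cong) (auto simp: orbit_size_def)
  finally show ?thesis .
qed

text \<open>
  A nonzero Pluecker coordinate makes the entries at the positions \<open>I\<close> coordinates on \<open>L\<close>, with
  dual basis \<open>b\<close>. The other entries of \<open>b\<close> are quotients of Pluecker coordinates by Cramer's rule.
\<close>

lemma plucker_dual_basis:
  fixes bs :: "(real ^ 'n ^ 'n) list"
  assumes L: "subspace L" "ordered_basis bs L" and len: "length bs = m" "length I = m"
    and nz: "plucker bs I \<noteq> 0"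
  shows "\<exists>b. (\<forall>i<m. b i \<in> L \<and> (\<forall>l<m. entry (b i) (I ! l) = (if i = l then 1 else 0))) \<and>
    (\<forall>B\<in>L. \<forall>j. entry B j = (\<Sum>i<m. entry B (I ! i) * entry (b i) j)) \<and>
    (\<forall>i<m. \<forall>j. plucker bs (I[i := j]) = entry (b i) j * plucker bs I)"
proof -
  define M where "M = Matrix.mat m m (\<lambda>(k, l). entry (bs ! k) (I ! l))"
  have M: "M \<in> carrier_mat m m" by (simp add: M_def)
  have pM: "plucker bs I = Determinant.det M"
    by (simp add: plucker_def M_def entry_def len)
  then have "Determinant.det M \<noteq> 0" using nz by simp
  from det_non_zero_imp_unit[OF M this, of "()"]
  obtain N where N: "N \<in> carrier_mat m m" "N * M = 1\<^sub>m m" "M * N = 1\<^sub>m m"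
    by (auto simp: Units_def ring_mat_simps)
  have NM: "(\<Sum>k<m. N $$ (i, k) * entry (bs ! k) (I ! l)) = (if i = l then 1 else 0)"
    if "i < m" "l < m" for i l
  proof -
    have "(N * M) $$ (i, l) = (\<Sum>k<m. N $$ (i, k) * entry (bs ! k) (I ! l))"
      using N(1) that by (simp add: M_def scalar_prod_def lessThan_atLeast0)
    then show ?thesis using that by (simp add: N(2))
  qed
  have MN: "(\<Sum>i<m. entry (bs ! k) (I ! i) * N $$ (i, l)) = (if k = l then 1 else 0)"
    if "k < m" "l < m" for k l
  proof -
    have "(M * N) $$ (k, l) = (\<Sum>i<m. entry (bs ! k) (I ! i) * N $$ (i, l))"
      using N(1) that by (simp add: M_def scalar_prod_def lessThan_atLeast0)
    then show ?thesis using that by (simp add: N(3))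
  qed
  define b where "b = (\<lambda>i. \<Sum>k<m. N $$ (i, k) *\<^sub>R (bs ! k))"
  have bL: "b i \<in> L" for i
  proof -
    have "bs ! k \<in> L" if "k < m" for k
      using L(2) that len(1) span_base[of "bs ! k" "set bs"] by (auto simp: ordered_basis_def)
    then show ?thesis unfolding b_def by (intro subspace_sum[OF L(1)] subspace_scale[OF L(1)]) auto
  qed
  have bI: "entry (b i) (I ! l) = (if i = l then 1 else 0)" if "i < m" "l < m" for i l
    using NM[OF that] by (simp add: b_def entry_simps)
  have basis: "entry (bs ! k) j = (\<Sum>i<m. entry (bs ! k) (I ! i) * entry (b i) j)"
    if k: "k < m" for k j
  proof -
    have "(\<Sum>i<m. entry (bs ! k) (I ! i) * entry (b i) j)
        = (\<Sum>i<m. \<Sum>l<m. entry (bs ! k) (I ! i) * N $$ (i, l) * entry (bs ! l) j)"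
      by (simp add: b_def entry_simps sum_distrib_left mult.assoc)
    also have "\<dots> = (\<Sum>l<m. \<Sum>i<m. entry (bs ! k) (I ! i) * N $$ (i, l) * entry (bs ! l) j)"
      by (rule sum.swap)
    also have "\<dots> = (\<Sum>l<m. (if k = l then 1 else 0) * entry (bs ! l) j)"
      using k by (intro sum.cong refl) (simp add: sum_distrib_right[symmetric] MN)
    also have "\<dots> = entry (bs ! k) j" using k by (rule sum_indicator_mult)
    finally show ?thesis by simp
  qed
  have all: "entry B j = (\<Sum>i<m. entry B (I ! i) * entry (b i) j)" if "B \<in> L" for B j
  proof -
    have "B \<in> span (set bs)" using that L(2) by (simp add: ordered_basis_def)
    then show ?thesis
    proof (induction rule: span_induct_alt)
      case (step c x y)
      then obtain k where "k < m" "x = bs ! k" using len(1) by (auto simp: in_set_conv_nth)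
      then have "entry x j = (\<Sum>i<m. entry x (I ! i) * entry (b i) j)" using basis by simp
      then show ?case using step(2)
        by (simp add: entry_simps distrib_right sum.distrib sum_distrib_left mult.assoc)
    qed (simp add: entry_simps)
  qed
  have pl: "plucker bs (I[i := j]) = entry (b i) j * plucker bs I" if i: "i < m" for i j
  proof -
    define x where "x = Matrix.vec m (\<lambda>i. entry (b i) j)"
    have x: "x \<in> carrier_vec m" by (simp add: x_def)
    define v where "v = M *\<^sub>v x"
    have v: "Matrix.vec_index v k = entry (bs ! k) j" if k: "k < m" for k
    proof -
      have "Matrix.vec_index v k = (\<Sum>i<m. entry (bs ! k) (I ! i) * entry (b i) j)"
        using k by (simp add: v_def M_def x_def scalar_prod_def lessThan_atLeast0)
      also have "\<dots> = entry (bs ! k) j" by (rule basis[OF k, symmetric])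
      finally show ?thesis .
    qed
    have dims: "dim_row M = m" "dim_col M = m" by (simp_all add: M_def)
    have "Matrix.mat m m (\<lambda>(k, l). entry (bs ! k) (I[i := j] ! l)) = replace_col M v i"
      unfolding replace_col_def dims
    proof (rule cong_mat[OF refl refl])
      fix k l assume kl: "k < m" "l < m"
      then have "M $$ (k, l) = entry (bs ! k) (I ! l)" by (simp add: M_def)
      then show "(case (k, l) of (k, l) \<Rightarrow> entry (bs ! k) (I[i := j] ! l))
          = (case (k, l) of (k, l) \<Rightarrow> if l = i then Matrix.vec_index v k else M $$ (k, l))"
        using kl(2) len(2) v[OF kl(1)] by (simp add: nth_list_update)
    qed
    then have "plucker bs (I[i := j]) = Determinant.det (replace_col M v i)"
      by (simp add: plucker_def entry_def len)
    also have "\<dots> = entry (b i) j * Determinant.det M"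
      using cramer_lemma_mat[OF M x i] i by (simp add: x_def v_def)
    finally show ?thesis by (simp add: pM)
  qed
  show ?thesis by (rule exI[of _ b]) (simp add: bL bI pl all[symmetric])
qed

text \<open>
  The quotients of Pluecker coordinates that describe a chart of the Grassmannian can be
  prescribed arbitrarily.
\<close>

lemma graph_subspace_exists:
  fixes I :: "('n::finite \<times> 'n) list" and T :: "nat \<Rightarrow> 'n \<times> 'n \<Rightarrow> real"
  assumes I: "distinct I" "set I \<subseteq> upper" "length I = m"
  shows "\<exists>L bs. L \<in> Gr_sym m \<and> ordered_basis bs L \<and> plucker bs I = 1 \<and>
    (\<forall>i<m. \<forall>j\<in>upper - set I. plucker bs (I[i := j]) = T i j)"
proof -
  define b :: "nat \<Rightarrow> real ^ 'n ^ 'n" where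
    "b = (\<lambda>i. \<chi> x y. if upper_rep x y = I ! i then 1 else if upper_rep x y \<in> set I then 0 else T i (upper_rep x y))"
  have ent: "entry (b i) p = (if p = I ! i then 1 else if p \<in> set I then 0 else T i p)"
    if "p \<in> upper" for p i
    unfolding entry_def b_def vec_lambda_beta upper_rep_of_upper[OF that] ..
  have bI: "entry (b i) (I ! l) = (if i = l then 1 else 0)" if "i < m" "l < m" for i l
    using that I nth_eq_iff_index_eq[OF I(1), of l i] by (subst ent) auto
  have sym: "b i \<in> sym_mats" for i by (rule sym_matsI) (simp add: b_def upper_rep_commute)
  have inj: "inj_on b {..<m}"
  proof (rule inj_onI)
    fix i l assume "i \<in> {..<m}" "l \<in> {..<m}" "b i = b l"
    then have "(1 :: real) = (if l = i then 1 else 0)" using bI[of i i] bI[of l i] by simp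
    then show "i = l" by (simp split: if_splits)
  qed
  define bs where "bs = map b [0..<m]"
  have set: "set bs = b ` {..<m}" by (auto simp: bs_def)
  have dist: "distinct bs" using inj by (simp add: bs_def distinct_map lessThan_atLeast0)
  have ind: "independent (set bs)"
  proof (rule independent_if_scalars_zero)
    fix f v assume f: "(\<Sum>v\<in>set bs. f v *\<^sub>R v) = 0" "v \<in> set bs"
    then obtain l where l: "l < m" "v = b l" by (auto simp: set)
    have "(\<Sum>i<m. f (b i) *\<^sub>R b i) = 0" using f(1) by (simp add: set sum.reindex[OF inj])
    then have "0 = entry (\<Sum>i<m. f (b i) *\<^sub>R b i) (I ! l)" by (simp add: entry_simps)
    also have "\<dots> = (\<Sum>i<m. f (b i) * (if i = l then 1 else 0))"
      unfolding entry_simps using l(1) by (intro sum.cong) (auto simp: bI)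
    also have "\<dots> = f (b l)" using l(1) by (rule sum_indicator_mult)
    finally show "f v = 0" by (simp add: l(2))
  qed simp
  define L where "L = span (set bs)"
  have basis: "ordered_basis bs L" using dist ind by (simp add: ordered_basis_def L_def)
  have sub: "subspace L" by (simp add: L_def)
  have "L \<subseteq> sym_mats"
    unfolding L_def using sym by (intro span_minimal sym_mats_subspace) (auto simp: set)
  moreover have "dim L = m"
    using dim_eq_card_independent[OF ind] distinct_card[OF dist] by (simp add: L_def bs_def)
  ultimately have Gr: "L \<in> Gr_sym m" using sub by (simp add: Gr_sym_def)
  have len: "length bs = m" by (simp add: bs_def)
  have "Matrix.mat m m (\<lambda>(k, l). entry (bs ! k) (I ! l)) = 1\<^sub>m m"
    by (rule eq_matI) (auto simp: bs_def bI)
  then have one: "plucker bs I = 1" by (simp add: plucker_def entry_def len)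
  from plucker_dual_basis[OF sub basis len I(3)] one obtain b' where
    b': "\<And>B j. B \<in> L \<Longrightarrow> entry B j = (\<Sum>i<m. entry B (I ! i) * entry (b' i) j)"
    "\<And>i j. i < m \<Longrightarrow> plucker bs (I[i := j]) = entry (b' i) j" by auto
  have "plucker bs (I[i := j]) = T i j" if i: "i < m" and j: "j \<in> upper - set I" for i j
  proof -
    have "b i \<in> L" unfolding L_def using i by (intro span_base) (simp add: set)
    from b'(1)[OF this, of j] have "entry (b i) j = (\<Sum>l<m. (if i = l then 1 else 0) * entry (b' l) j)"
      using i by (simp add: bI)
    also have "\<dots> = entry (b' i) j" using i by (rule sum_indicator_mult)
    finally have "entry (b i) j = entry (b' i) j" .
    moreover have "entry (b i) j = T i j"
      using j i I(3) nth_mem[of i I] by (subst ent) auto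
    ultimately show ?thesis using b'(2)[OF i] by simp
  qed
  with Gr basis one show ?thesis by blast
qed

section \<open>Degenerate subspaces lie in a hypersurface\<close>

text \<open>
  The symmetric matrix whose entries are the parameters, except for the two entries normalized to
  \<open>1\<close>. The right summand of the parameter index is reserved for the parameters of the subspace.
\<close>

definition sym_coord :: "'n::finite \<times> 'n \<Rightarrow> 'n \<times> 'n \<Rightarrow> ('n \<times> 'n + 'b \<Rightarrow> real) \<Rightarrow> 'n \<Rightarrow> 'n \<Rightarrow> real" where
  "sym_coord p q x i j = (if upper_rep i j \<in> {p, q} then 1 else x (Inl (upper_rep i j)))"

lemma sep_poly_sym_coord: "sep_poly K 1 (\<lambda>x. sym_coord p q x i j)"
  unfolding sym_coord_def by (intro sep_poly_if sep_poly_const sep_poly_var) simp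

lemma lagrange_form_cong:
  assumes "\<And>v. v \<in> V \<Longrightarrow> T v = T' v"
  shows "lagrange_form V D c T q = lagrange_form V D c T' q"
  unfolding lagrange_form_def using assms by (intro sum.cong prod.cong arg_cong2[of _ _ _ _ "(*)"]) auto

lemma orthogonal_to_dual_basis:
  fixes C :: "real ^ 'n ^ 'n"
  assumes I: "distinct I" "set I \<subseteq> upper" "length I = m" and i: "i < m"
    and B: "B \<in> sym_mats" "\<And>l. l < m \<Longrightarrow> entry B (I ! l) = (if i = l then 1 else 0)"
    and C: "C \<in> sym_mats" "B \<bullet> C = 0"
  shows "orbit_size (I ! i) * entry C (I ! i)
    = - (\<Sum>j\<in>upper - set I. orbit_size j * entry C j * entry B j)"
proof -
  have "0 = (\<Sum>p\<in>upper. entry B p * (orbit_size p * entry C p))"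
    using sym_inner_upper[OF B(1) C(1)] C(2) by simp
  also have "\<dots> = (\<Sum>p\<in>upper - set I. entry B p * (orbit_size p * entry C p))
      + (\<Sum>p\<in>set I. entry B p * (orbit_size p * entry C p))"
    by (rule sum.subset_diff[OF I(2)]) simp
  also have "(\<Sum>p\<in>set I. entry B p * (orbit_size p * entry C p))
      = (\<Sum>l<m. entry B (I ! l) * (orbit_size (I ! l) * entry C (I ! l)))"
    using sum.reindex_bij_betw[OF bij_betw_nth[OF I(1), of "{..<m}" "set I"],
        of "\<lambda>p. entry B p * (orbit_size p * entry C p)"] I(3)
    by (simp add: set_conv_nth image_def lessThan_def Collect_disj_eq) 
  also have "\<dots> = (\<Sum>l<m. (if i = l then 1 else 0) * (orbit_size (I ! l) * entry C (I ! l)))"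
    by (intro sum.cong refl) (simp add: B(2))
  also have "\<dots> = orbit_size (I ! i) * entry C (I ! i)" using i by (rule sum_indicator_mult)
  finally show ?thesis by (simp add: mult.commute mult.left_commute)
qed

lemma orbit_size_nonzero: "orbit_size p \<noteq> 0"
  by (simp add: orbit_size_def)

lemma sym_zero_if_upper_zero:
  assumes "A \<in> sym_mats" "\<And>p. p \<in> upper \<Longrightarrow> entry A p = 0"
  shows "A = 0"
proof -
  have "A $ i $ j = 0" for i j
    using assms(2)[OF upper_rep_in_upper[of i j]] sym_upper_rep[OF assms(1), of i j] by (simp add: entry_def)
  then show ?thesis by (simp add: vec_eq_iff)
qed

text \<open>
  A degenerate \<open>L\<close> in the chart of \<open>I\<close> is determined by the pair \<open>(A, C)\<close> and by its chart
  coordinates outside one row and one column, so it lies in one of finitely many families with \<open>m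
  (N - m) - 1\<close> parameters, where \<open>N\<close> is the number of positions in \<open>upper\<close>. The index \<open>(W, p, q,
  i0, j0)\<close> of a family records a column basis of \<open>A\<close>, the entries of \<open>A\<close> and \<open>C\<close> normalized to
  \<open>1\<close>, and the chart coordinates of \<open>A\<close> and \<open>C\<close> that serve as denominators. The extra factor, the
  Pluecker coordinate at \<open>I\<close>, takes care of the spaces outside the chart.
\<close>

lemma degenerate_in_hypersurface:
  fixes I :: "('n::finite \<times> 'n) list"
  assumes I: "distinct I" "set I \<subseteq> upper" "length I = m"
  shows "\<exists>(f :: ('n \<times> 'n) list real_mpoly) k. form_in (plucker_indices m) k f \<and>
    (\<exists>L\<in>Gr_sym m. \<exists>bs. ordered_basis bs L \<and> mpoly_eval (plucker bs) f \<noteq> 0) \<and>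
    (\<forall>L\<in>Gr_sym m. rank_degenerate L \<longrightarrow>
      (\<forall>bs. ordered_basis bs L \<longrightarrow> mpoly_eval (plucker bs) f = 0))"
proof -
  define J where "J = upper - set I"
  define V where "V = {..<m} \<times> J"
  have finJ: "finite J" by (simp add: J_def)
  define S :: "('n set \<times> ('n \<times> 'n) \<times> ('n \<times> 'n) \<times> nat \<times> ('n \<times> 'n)) set"
    where "S = {(W, p, q, i0, j0). p \<in> upper \<inter> W \<times> W \<and> q \<in> upper \<inter> (- W) \<times> (- W) \<and> i0 < m \<and> j0 \<in> J}"
  define K :: "'n set \<times> ('n \<times> 'n) \<times> ('n \<times> 'n) \<times> nat \<times> ('n \<times> 'n) \<Rightarrow> ('n \<times> 'n + nat \<times> ('n \<times> 'n)) set"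
    where "K = (\<lambda>(W, p, q, i0, j0). Inl ` (upper - {p, q}) \<union> Inr ` (({..<m} - {i0}) \<times> (J - {j0})))"
  define a where "a = (\<lambda>W p q (x :: 'n \<times> 'n + nat \<times> ('n \<times> 'n) \<Rightarrow> real) r.
      pair_form W 1 (sym_coord p q x) (fst r) (snd r))"
  define w where "w = (\<lambda>W p q (x :: 'n \<times> 'n + nat \<times> ('n \<times> 'n) \<Rightarrow> real) r.
      orbit_size r * pair_form (- W) (-1) (sym_coord p q x) (fst r) (snd r))"
  define g where "g = (\<lambda>(W, p, q, i0, j0) (i, j) x. flag_num m J i0 j0 (\<lambda>i. a W p q x (I ! i)) (a W p q x)
      (\<lambda>i. w W p q x (I ! i)) (w W p q x) (\<lambda>i j. x (Inr (i, j))) i j)"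
  define h where "h = (\<lambda>(W, p, q, i0, j0) x. a W p q x (I ! i0) * w W p q x j0)"
  have spa: "sep_poly K' 3 (\<lambda>x. a W p q x r)" for K' W p q r
    unfolding a_def by (intro sep_poly_pair_form sep_poly_sym_coord)
  have spw: "sep_poly K' 3 (\<lambda>x. w W p q x r)" for K' W p q r
    unfolding w_def
    by (rule sep_poly_times[OF sep_poly_const[of _ 0] sep_poly_pair_form[OF sep_poly_sym_coord]]) simp
  have "finite S"
  proof (rule finite_subset)
    show "S \<subseteq> UNIV \<times> UNIV \<times> UNIV \<times> {..<m} \<times> UNIV" by (auto simp: S_def)
  qed simp
  moreover have "finite V" using finJ by (simp add: V_def)
  moreover have "finite (K s)" for s using finJ by (auto simp: K_def split: prod.split)
  moreover have "card (K s) < card V" if "s \<in> S" for s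
  proof -
    obtain W p q i0 j0 where s: "s = (W, p, q, i0, j0)" by (cases s)
    have pq: "p \<in> upper" "q \<in> upper" "p \<noteq> q" "i0 < m" "j0 \<in> J" using that by (auto simp: S_def s)
    have N: "card (upper :: ('n \<times> 'n) set) = m + card J"
      unfolding J_def using I card_Diff_subset[of "set I" upper] card_mono[of upper "set I"]
      by (simp add: distinct_card)
    have "card (K s) = card (upper - {p, q}) + card (({..<m} - {i0}) \<times> (J - {j0}))"
      unfolding K_def s prod.case using finJ
      by (subst card_Un_disjoint) (auto simp: card_image)
    also have "card (upper - {p, q}) = m + card J - 2"
      using pq N card_Diff_subset[of "{p, q}" upper] by simp
    also have "card (({..<m} - {i0}) \<times> (J - {j0})) = (m - 1) * (card J - 1)"
      using pq finJ by (simp add: card_cartesian_product)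
    finally have K: "card (K s) = m + card J - 2 + (m - 1) * (card J - 1)" .
    have "card J > 0" using pq finJ by (auto simp: card_gt_0_iff)
    then obtain c' where "card J = Suc c'" by (cases "card J") auto
    moreover obtain m' where "m = Suc m'" using pq by (cases m) auto
    ultimately show ?thesis using K by (simp add: V_def card_cartesian_product)
  qed
  moreover have "sep_poly (K s) 7 (g s v)" for s v
    unfolding g_def
    by (cases s; cases v) (simp, intro sep_poly_flag_num spa spw sep_poly_var order_refl)
  moreover have "sep_poly (K s) 7 (h s)" for s
  proof -
    obtain W p q i0 j0 where s: "s = (W, p, q, i0, j0)" by (cases s)
    show ?thesis unfolding h_def s prod.case by (rule sep_poly_times[OF spa spw]) simp
  qed
  ultimately have "\<exists>D c. (\<exists>T. lagrange_form V D c T 1 \<noteq> 0) \<and>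
    (\<forall>s\<in>S. \<forall>x. (\<forall>k. k \<notin> K s \<longrightarrow> x k = 0) \<longrightarrow> lagrange_form V D c (\<lambda>v. g s v x) (h s x) = 0)"
    by (intro low_dimensional_image_in_hypersurface[where \<delta> = 7])
  then obtain D c T where T: "lagrange_form V D c T 1 \<noteq> 0"
    and van: "\<And>s x. s \<in> S \<Longrightarrow> (\<And>k. k \<notin> K s \<Longrightarrow> x k = 0) \<Longrightarrow> lagrange_form V D c (\<lambda>v. g s v x) (h s x) = 0"
    by blast
  let ?ix = "\<lambda>(i, j). I[i := j]"
  have idx: "?ix ` V \<subseteq> plucker_indices m" "I \<in> plucker_indices m"
    using I(3) by (auto simp: plucker_indices_def)
  from lagrange_form_as_mpoly[OF idx] obtain F where
    F: "form_in (plucker_indices m) (card V * (D - 1)) F"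
    "\<And>p. mpoly_eval p F = lagrange_form V D c (\<lambda>v. p (?ix v)) (p I)" by blast
  define f where "f = mpoly_var I * F"
  have form: "form_in (plucker_indices m) (1 + card V * (D - 1)) f"
    unfolding f_def by (intro form_in_mult form_in_var idx(2) F(1))
  have ev: "mpoly_eval p f = p I * lagrange_form V D c (\<lambda>v. p (?ix v)) (p I)" for p
    by (simp add: f_def mpoly_eval_mult mpoly_eval_var F(2))
  have "\<exists>L\<in>Gr_sym m. \<exists>bs. ordered_basis bs L \<and> mpoly_eval (plucker bs) f \<noteq> 0"
  proof -
    obtain L bs where L: "L \<in> Gr_sym m" "ordered_basis bs L" "plucker bs I = 1"
      "\<And>i j. i < m \<Longrightarrow> j \<in> J \<Longrightarrow> plucker bs (I[i := j]) = T (i, j)"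
      using graph_subspace_exists[OF I, of "\<lambda>i j. T (i, j)"] unfolding J_def by blast
    have "lagrange_form V D c (\<lambda>v. plucker bs (?ix v)) 1 = lagrange_form V D c T 1"
      using L(4) by (intro lagrange_form_cong) (auto simp: V_def)
    then have "mpoly_eval (plucker bs) f \<noteq> 0" using T by (simp add: ev L(3))
    then show ?thesis using L(1,2) by blast
  qed
  moreover have "mpoly_eval (plucker bs) f = 0"
    if L: "L \<in> Gr_sym m" "rank_degenerate L" "ordered_basis bs L" for L bs
  proof (cases "plucker bs I = 0")
    case False
    have sub: "subspace L" "L \<subseteq> sym_mats" "dim L = m" using L(1) by (auto simp: Gr_sym_def)
    have "length bs = m"
      using L(3) sub(3) dim_span_eq_card_independent[of "set bs"]
      by (auto simp: ordered_basis_def distinct_card)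
    from plucker_dual_basis[OF sub(1) L(3) this I(3) False] obtain b where
      bL: "\<And>i. i < m \<Longrightarrow> b i \<in> L" and
      bI: "\<And>i l. i < m \<Longrightarrow> l < m \<Longrightarrow> entry (b i) (I ! l) = (if i = l then 1 else 0)" and
      dual: "\<And>B j. B \<in> L \<Longrightarrow> entry B j = (\<Sum>i<m. entry B (I ! i) * entry (b i) j)" and
      pl: "\<And>i j. i < m \<Longrightarrow> plucker bs (I[i := j]) = entry (b i) j * plucker bs I" by blast
    obtain A C where A: "A \<in> L" "A \<noteq> 0" and C: "C \<in> sym_mats" "C \<noteq> 0" and AC: "A ** C = 0"
      and orth: "\<And>B. B \<in> L \<Longrightarrow> B \<bullet> C = 0"
      using L(2) by (auto simp: rank_degenerate_def)
    have symA: "A \<in> sym_mats" using A sub by blast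
    obtain p W q \<alpha> \<gamma> y where p: "p \<in> upper \<inter> W \<times> W" and q: "q \<in> upper \<inter> (- W) \<times> (- W)"
      and nz: "\<alpha> \<noteq> 0" "\<gamma> \<noteq> 0" and y: "\<And>i j. y i j = y j i" "y (fst p) (snd p) = 1" "y (fst q) (snd q) = 1"
      and AW: "\<And>i j. A $ i $ j = \<alpha> * pair_form W 1 y i j"
      and CW: "\<And>i j. C $ i $ j = \<gamma> * pair_form (- W) (-1) y i j"
      by (rule annihilating_pair_parametrized[OF symA A(2) C AC]) (rule that)
    define u where "u = (\<lambda>r. orbit_size r * entry C r)"
    have uI: "u (I ! i) = - (\<Sum>j\<in>J. u j * entry (b i) j)" if "i < m" for i
      unfolding u_def J_def
      using orthogonal_to_dual_basis[OF I that _ bI[OF that] C(1) orth[OF bL[OF that]]] bL[OF that] sub(2)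
      by (simp add: subset_iff)
    have "\<exists>i0<m. entry A (I ! i0) \<noteq> 0"
    proof (rule ccontr)
      assume "\<not> ?thesis"
      then have "entry A r = 0" for r by (subst dual[OF A(1)]) simp
      then show False using sym_zero_if_upper_zero[OF symA] A(2) by blast
    qed
    then obtain i0 where i0: "i0 < m" "entry A (I ! i0) \<noteq> 0" by blast
    have "\<exists>j0\<in>J. u j0 \<noteq> 0"
    proof (rule ccontr)
      assume no: "\<not> ?thesis"
      have "u r = 0" if r: "r \<in> upper" for r
      proof (cases "r \<in> J")
        case True
        then show ?thesis using no by blast
      next
        case False
        then have "r \<in> set I" using r by (simp add: J_def)
        then obtain i where i: "i < m" "r = I ! i" using I(3) by (auto simp: in_set_conv_nth)
        show ?thesis unfolding i(2) uI[OF i(1)] using no by simp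
      qed
      then have "entry C r = 0" if "r \<in> upper" for r
        using that by (simp add: u_def orbit_size_nonzero)
      then show False using sym_zero_if_upper_zero[OF C(1)] C(2) by blast
    qed
    then obtain j0 where j0: "j0 \<in> J" "u j0 \<noteq> 0" by blast
    define s where "s = (W, p, q, i0, j0)"
    have s: "s \<in> S" using p q i0(1) j0(1) by (simp add: S_def s_def)
    define x :: "'n \<times> 'n + nat \<times> ('n \<times> 'n) \<Rightarrow> real" where
      "x = (\<lambda>k. if k \<in> K s then (case k of Inl r \<Rightarrow> y (fst r) (snd r) | Inr (i, j) \<Rightarrow> entry (b i) j) else 0)"
    have coord: "sym_coord p q x = y"
    proof (intro ext)
      fix i j
      have upper_rep: "y (fst (upper_rep i j)) (snd (upper_rep i j)) = y i j" using y(1) by (simp add: upper_rep_def)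
      show "sym_coord p q x i j = y i j"
      proof (cases "upper_rep i j \<in> {p, q}")
        case True
        then have "y (fst (upper_rep i j)) (snd (upper_rep i j)) = 1" using y(2,3) by auto
        then show ?thesis using True upper_rep by (simp add: sym_coord_def)
      next
        case False
        then have "Inl (upper_rep i j) \<in> K s" using upper_rep_in_upper[of i j] by (auto simp: K_def s_def)
        then show ?thesis using False upper_rep by (simp add: sym_coord_def x_def)
      qed
    qed
    have ax: "a W p q x r = entry A r / \<alpha>" for r
      using nz(1) by (simp add: a_def coord entry_def AW)
    have wx: "w W p q x r = u r / \<gamma>" for r
      using nz(2) by (simp add: w_def u_def coord entry_def CW)
    have hx: "h s x = a W p q x (I ! i0) * w W p q x j0" by (simp add: h_def s_def)
    have hnz: "h s x \<noteq> 0" unfolding hx ax wx using i0 j0 nz by simp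
    have gx: "g s (i, j) x = entry (b i) j * h s x" if ij: "i < m" "j \<in> J" for i j
      unfolding hx unfolding g_def s_def prod.case
    proof (rule flag_num_eq[OF finJ i0(1) j0(1) _ _ _ ij])
      fix j
      show "a W p q x j = (\<Sum>i<m. entry (b i) j * a W p q x (I ! i))"
        unfolding ax dual[OF A(1), of j] sum_divide_distrib by (simp add: mult.commute)
    next
      fix i assume "i < m"
      then show "w W p q x (I ! i) = - (\<Sum>j\<in>J. w W p q x j * entry (b i) j)"
        unfolding wx by (subst uI) (simp_all add: sum_divide_distrib)
    next
      fix i j assume "i < m" "j \<in> J" "i \<noteq> i0" "j \<noteq> j0"
      then have "Inr (i, j) \<in> K s" by (auto simp: K_def s_def)
      then show "x (Inr (i, j)) = entry (b i) j" by (simp add: x_def)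
    qed
    define r where "r = plucker bs I / h s x"
    have "lagrange_form V D c (\<lambda>v. g s v x) (h s x) = 0" by (rule van[OF s]) (simp add: x_def)
    then have "lagrange_form V D c (\<lambda>v. r * g s v x) (r * h s x) = 0" by (rule lagrange_form_scale)
    moreover have "r * h s x = plucker bs I" using hnz by (simp add: r_def)
    moreover have "r * g s v x = plucker bs (?ix v)" if vV: "v \<in> V" for v
    proof -
      obtain i j where v: "v = (i, j)" "i < m" "j \<in> J" using vV unfolding V_def by blast
      show ?thesis using hnz by (simp add: v(1) gx[OF v(2,3)] pl[OF v(2)] r_def)
    qed
    ultimately have "lagrange_form V D c (\<lambda>v. plucker bs (?ix v)) (plucker bs I) = 0"
      using lagrange_form_cong[of V "\<lambda>v. r * g s v x" "\<lambda>v. plucker bs (?ix v)"] by simp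
    then show ?thesis by (simp add: ev)
  qed (simp add: ev)
  ultimately show ?thesis using form by blast
qed

section \<open>Spaces without a semidefinite matrix of rank n - d\<close>

theorem lemma3p7:
  fixes d m :: nat and E :: "(real ^ 'n ^ 'n) set set"
  assumes "d \<le> CARD('n) - 1"
    and "m \<le> (CARD('n) + 1) choose 2"
    and "int m \<ge> int d * int CARD('n) - int (d choose 2) - int CARD('n) + int d + 1"
    and "E = {L \<in> Gr_sym m. (\<exists>A\<in>L. positive_definite A) \<and>
               \<not> (\<exists>A\<in>L. positive_semidefinite A \<and> rank A = CARD('n) - d)}"
  shows "\<exists>Z. zariski_closed_Gr m Z \<and> Z \<subset> Gr_sym m \<and> E \<subseteq> Z"
proof -
  have "m \<le> card (upper :: ('n \<times> 'n) set)" using assms(2) by (simp add: card_upper)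
  then obtain P :: "('n \<times> 'n) set" where P: "P \<subseteq> upper" "card P = m" "finite P"
    by (rule obtain_subset_with_card_n)
  obtain I where I: "set I = P" "distinct I" using finite_distinct_list[OF P(3)] by blast
  have "length I = m" using P(2) I distinct_card by fastforce
  from degenerate_in_hypersurface[OF I(2) _ this] P(1) I(1)
  obtain f :: "('n \<times> 'n) list real_mpoly" and k where
    f: "form_in (plucker_indices m) k f"
    "\<exists>L\<in>Gr_sym m. \<exists>bs. ordered_basis bs L \<and> mpoly_eval (plucker bs) f \<noteq> 0"
    "\<And>L bs. L \<in> Gr_sym m \<Longrightarrow> rank_degenerate L \<Longrightarrow> ordered_basis bs L \<Longrightarrow> mpoly_eval (plucker bs) f = 0"
    by blast
  define Z :: "(real ^ 'n ^ 'n) set set" where "Z = {L \<in> Gr_sym m. \<forall>f'\<in>{f}. \<forall>bs. ordered_basis bs L \<longrightarrow> mpoly_eval (plucker bs) f' = 0}"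
  have "zariski_closed_Gr m Z"
    unfolding zariski_closed_Gr_def
    by (rule exI[of _ "{f}"]) (use form_inD[OF f(1)] in \<open>simp add: Z_def\<close>)
  moreover have "Z \<subset> Gr_sym m" using f(2) by (auto simp: Z_def)
  moreover have "E \<subseteq> Z"
  proof
    fix L assume L: "L \<in> E"
    then obtain A where LA: "L \<in> Gr_sym m" "A \<in> L" "positive_definite A"
      and no: "\<not> (\<exists>A\<in>L. positive_semidefinite A \<and> rank A = CARD('n) - d)"
      unfolding assms(4) by blast
    have "rank_degenerate L"
      using nondegenerate_contains_psd_of_rank[OF LA(1) _ LA(2,3) assms(1,3)] no by blast
    then show "L \<in> Z" using LA(1) f(3) by (simp add: Z_def)
  qed
  ultimately show ?thesis by blast
qed

end
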